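(* Let $s\in(0,1)$, let $n>2s$, let $\Omega\subset\mathbb{R}^n$ be a bounded open set with smooth boundary, let $2<p\le \frac{2n}{n-2s}$, and let $u_0\in H_0^s(\Omega)$. Let $u$ be the unique weak solution of $$\frac{u_t}{|x|^{2s}}+(-\Delta)^su+(-\Delta)^su_t=|u|^{p-2}u\ \text{ in }\Omega\times(0,T),\qquad u=0\ \text{ on }\partial\Omega\times(0,T),\qquad u(\cdot,0)=u_0,$$ with maximal existence time $T$. Assume that $u$ blows up at the finite time $T$ in the sense that $$\lim_{t\to T^-}\left(\int_\Omega\frac{u(t)^2}{|x|^{2s}}dx+\left\|(-\Delta)^{\frac s2}u(t)\right\|_2^2\right)=\infty.$$ Then $$T\ge\frac{1}{C^p(p-2)}\left(\int_\Omega\frac{u_0^2}{|x|^{2s}}dx+\left\|(-\Delta)^{\frac s2}u_0\right\|_2^2\right)^{\frac{2-p}{2}},$$ and for all $t\in[0,T)$ $$\int_\Omega\frac{u(t)^2}{|x|^{2s}}dx+\left\|(-\Delta)^{\frac s2}u(t)\right\|_2^2\ge C^{\frac{2p}{2-p}}(p-2)^{\frac{2}{2-p}}(T-t)^{\frac{2}{2-p}}.$$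
   Context: $(\cdot,\cdot)$ is the inner product of $L^2(\Omega)$ and $\|\cdot\|_r$ the norm of $L^r(\Omega)$. Let $e_i$, $\lambda_i$ be the ($L^2$-orthonormal) eigenfunctions and the eigenvalues of $-\Delta$ in $\Omega$ with homogeneous Dirichlet condition. For $\phi=\sum_i a_ie_i$, $a_i=\int_\Omega\phi e_i\,dx$, the spectral fractional Laplacian is $(-\Delta)^{s}\phi=\sum_i a_i\lambda_i^{s}e_i$, and $(-\Delta)^{s/2}\phi=\sum_i a_i\lambda_i^{s/2}e_i$. The Hilbert space $H_0^s(\Omega)=\{\phi=\sum_i a_ie_i\in L^2(\Omega):\sum_i a_i^2\lambda_i^s<\infty\}$ has norm $\|\phi\|_{H_0^s}=\|(-\Delta)^{s/2}\phi\|_2$. The Hardy inequality $\int_\Omega\frac{\phi^2}{|x|^{2s}}dx\le C_*\|(-\Delta)^{s/2}\phi\|_2^2$ holds on $H_0^s(\Omega)$ for some constant $C_*>0$. $C>0$ is the best constant in the embedding inequality $\|\phi\|_p\le C\|(-\Delta)^{s/2}\phi\|_2$, $\phi\in H_0^s(\Omega)$. A weak solution on $\Omega\times[0,T)$ is a function $u\in L^\infty(0,T;H_0^s(\Omega))$ with $u_t\in L^2(0,T;H_0^s(\Omega))$, $u(\cdot,0)=u_0$, such that for every $\nu\in H_0^s(\Omega)$ and a.e. $t\in(0,T)$, $$(|x|^{-2s}u_t,\nu)+((-\Delta)^{s/2}u,(-\Delta)^{s/2}\nu)+((-\Delta)^{s/2}u_t,(-\Delta)^{s/2}\nu)=(|u|^{p-2}u,\nu).$$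 It is known that for every $u_0\in H_0^s(\Omega)$ there is a unique local weak solution; it is continuous in time with values in $H_0^s(\Omega)$. The maximal existence time $T\in(0,\infty]$ is the supremum of the times $T'$ for which a weak solution on $\Omega\times[0,T')$ exists. *)

theory Defs
  imports "HOL-Analysis.Analysis"
begin

section \<open>Smooth functions and domains with smooth boundary\<close>

text \<open>\<open>Ck_on k S f\<close> is meant for open \<open>S\<close>: all iterated partial derivatives of order up to \<open>k\<close>
  exist and are continuous on \<open>S\<close>.\<close>

primrec Ck_on :: "nat \<Rightarrow> 'a::euclidean_space set \<Rightarrow> ('a \<Rightarrow> 'b::real_normed_vector) \<Rightarrow> bool" where
  "Ck_on 0 S f \<longleftrightarrow> continuous_on S f"
| "Ck_on (Suc k) S f \<longleftrightarrow>
     (\<forall>x\<in>S. f differentiable (at x)) \<and>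
     (\<forall>b\<in>Basis. Ck_on k S (\<lambda>x. frechet_derivative f (at x) b))"

definition smooth_on :: "'a::euclidean_space set \<Rightarrow> ('a \<Rightarrow> 'b::real_normed_vector) \<Rightarrow> bool" where
  "smooth_on S f \<longleftrightarrow> (\<forall>k. Ck_on k S f)"

text \<open>Near every boundary point the set is, after a rotation of the coordinate axes, the region
  strictly above the graph of a smooth function.  The unit vector \<open>v\<close> is the direction of the last
  rotated coordinate; \<open>y - (y \<bullet> v) *\<^sub>R v\<close> collects the others, so only the values of \<open>\<gamma>\<close>
  on the hyperplane orthogonal to \<open>v\<close> matter.\<close>

definition smooth_boundary :: "'a::euclidean_space set \<Rightarrow> bool" where
  "smooth_boundary \<Omega> \<longleftrightarrow>
     (\<forall>x\<in>frontier \<Omega>. \<exists>r>0. \<exists>v. norm v = 1 \<and>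
        (\<exists>\<gamma> :: 'a \<Rightarrow> real. smooth_on UNIV \<gamma> \<and>
           \<Omega> \<inter> ball x r = {y \<in> ball x r. y \<bullet> v > \<gamma> (y - (y \<bullet> v) *\<^sub>R v)}))"

definition laplacian :: "('a::euclidean_space \<Rightarrow> real) \<Rightarrow> 'a \<Rightarrow> real" where
  "laplacian f x =
     (\<Sum>b\<in>Basis. frechet_derivative (\<lambda>y. frechet_derivative f (at y) b) (at x) b)"


section \<open>Lebesgue spaces\<close>

text \<open>Elements of \<open>L\<^sup>r(\<Omega>)\<close> are represented by functions, not by classes modulo null sets;
  norms, inner products and integrals only depend on the class.\<close>

definition Lp_space :: "real \<Rightarrow> 'a::euclidean_space set \<Rightarrow> ('a \<Rightarrow> real) set" where
  "Lp_space r \<Omega> =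
     {f. f \<in> borel_measurable (lebesgue_on \<Omega>) \<and>
         integrable (lebesgue_on \<Omega>) (\<lambda>x. \<bar>f x\<bar> powr r)}"

definition Lp_norm :: "real \<Rightarrow> 'a::euclidean_space set \<Rightarrow> ('a \<Rightarrow> real) \<Rightarrow> real" where
  "Lp_norm r \<Omega> f = (LINT x|lebesgue_on \<Omega>. \<bar>f x\<bar> powr r) powr (1 / r)"

definition L2_inner :: "'a::euclidean_space set \<Rightarrow> ('a \<Rightarrow> real) \<Rightarrow> ('a \<Rightarrow> real) \<Rightarrow> real" where
  "L2_inner \<Omega> f g = (LINT x|lebesgue_on \<Omega>. f x * g x)"


section \<open>The Dirichlet eigensystem and the spectral fractional Laplacian\<close>

text \<open>\<open>e\<close> is an \<open>L\<^sup>2\<close>-orthonormal basis of classical Dirichlet eigenfunctions of \<open>-\<Delta>\<close>, with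
  eigenvalues \<open>lam\<close> repeated according to multiplicity.  These are positive by the maximum principle,
  so \<open>powr\<close> below is a genuine power.\<close>

definition dirichlet_eigensystem ::
  "'a::euclidean_space set \<Rightarrow> (nat \<Rightarrow> 'a \<Rightarrow> real) \<Rightarrow> (nat \<Rightarrow> real) \<Rightarrow> bool" where
  "dirichlet_eigensystem \<Omega> e lam \<longleftrightarrow>
     (\<forall>i. continuous_on (closure \<Omega>) (e i) \<and> (\<forall>x\<in>frontier \<Omega>. e i x = 0) \<and>
          Ck_on 2 \<Omega> (e i) \<and> (\<forall>x\<in>\<Omega>. - laplacian (e i) x = lam i * e i x)) \<and>
     (\<forall>i j. L2_inner \<Omega> (e i) (e j) = (if i = j then 1 else 0)) \<and>
     (\<forall>f\<in>Lp_space 2 \<Omega>.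
        (\<lambda>N. Lp_norm 2 \<Omega> (\<lambda>x. f x - (\<Sum>i<N. L2_inner \<Omega> f (e i) * e i x))) \<longlonglongrightarrow> 0)"

text \<open>\<open>frac_lap \<Omega> e lam r \<phi>\<close> is \<open>(-\<Delta>)\<^sup>r \<phi> = \<Sum>\<^sub>i a\<^sub>i \<lambda>\<^sub>i\<^sup>r e\<^sub>i\<close>, the series being taken in
  \<open>L\<^sup>2(\<Omega>)\<close>; its sum is determined up to a null set.\<close>

definition frac_lap ::
  "'a::euclidean_space set \<Rightarrow> (nat \<Rightarrow> 'a \<Rightarrow> real) \<Rightarrow> (nat \<Rightarrow> real) \<Rightarrow> real \<Rightarrow> ('a \<Rightarrow> real) \<Rightarrow> 'a \<Rightarrow> real"
  where
  "frac_lap \<Omega> e lam r \<phi> =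
     (SOME g. g \<in> Lp_space 2 \<Omega> \<and>
        (\<lambda>N. Lp_norm 2 \<Omega> (\<lambda>x. g x - (\<Sum>i<N. L2_inner \<Omega> \<phi> (e i) * lam i powr r * e i x)))
          \<longlonglongrightarrow> 0)"

definition Hs0 ::
  "'a::euclidean_space set \<Rightarrow> (nat \<Rightarrow> 'a \<Rightarrow> real) \<Rightarrow> (nat \<Rightarrow> real) \<Rightarrow> real \<Rightarrow> ('a \<Rightarrow> real) set" where
  "Hs0 \<Omega> e lam s =
     {\<phi>\<in>Lp_space 2 \<Omega>. summable (\<lambda>i. (L2_inner \<Omega> \<phi> (e i))\<^sup>2 * lam i powr s)}"

definition Hs0_inner ::
  "'a::euclidean_space set \<Rightarrow> (nat \<Rightarrow> 'a \<Rightarrow> real) \<Rightarrow> (nat \<Rightarrow> real) \<Rightarrow> real \<Rightarrow>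
     ('a \<Rightarrow> real) \<Rightarrow> ('a \<Rightarrow> real) \<Rightarrow> real" where
  "Hs0_inner \<Omega> e lam s \<phi> \<psi> =
     L2_inner \<Omega> (frac_lap \<Omega> e lam (s / 2) \<phi>) (frac_lap \<Omega> e lam (s / 2) \<psi>)"

definition Hs0_norm ::
  "'a::euclidean_space set \<Rightarrow> (nat \<Rightarrow> 'a \<Rightarrow> real) \<Rightarrow> (nat \<Rightarrow> real) \<Rightarrow> real \<Rightarrow> ('a \<Rightarrow> real) \<Rightarrow> real"
  where
  "Hs0_norm \<Omega> e lam s \<phi> = Lp_norm 2 \<Omega> (frac_lap \<Omega> e lam (s / 2) \<phi>)"

definition hardy_inequality ::
  "'a::euclidean_space set \<Rightarrow> (nat \<Rightarrow> 'a \<Rightarrow> real) \<Rightarrow> (nat \<Rightarrow> real) \<Rightarrow> real \<Rightarrow> real \<Rightarrow> bool" where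
  "hardy_inequality \<Omega> e lam s K \<longleftrightarrow>
     (\<forall>\<phi>\<in>Hs0 \<Omega> e lam s.
        integrable (lebesgue_on \<Omega>) (\<lambda>x. (\<phi> x)\<^sup>2 / norm x powr (2 * s)) \<and>
        (LINT x|lebesgue_on \<Omega>. (\<phi> x)\<^sup>2 / norm x powr (2 * s)) \<le> K * (Hs0_norm \<Omega> e lam s \<phi>)\<^sup>2)"

definition embedding_inequality ::
  "'a::euclidean_space set \<Rightarrow> (nat \<Rightarrow> 'a \<Rightarrow> real) \<Rightarrow> (nat \<Rightarrow> real) \<Rightarrow> real \<Rightarrow> real \<Rightarrow> real \<Rightarrow> bool"
  where
  "embedding_inequality \<Omega> e lam s p K \<longleftrightarrow>
     (\<forall>\<phi>\<in>Hs0 \<Omega> e lam s. \<phi> \<in> Lp_space p \<Omega> \<and> Lp_norm p \<Omega> \<phi> \<le> K * Hs0_norm \<Omega> e lam s \<phi>)"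

definition best_embedding_constant ::
  "'a::euclidean_space set \<Rightarrow> (nat \<Rightarrow> 'a \<Rightarrow> real) \<Rightarrow> (nat \<Rightarrow> real) \<Rightarrow> real \<Rightarrow> real \<Rightarrow> real \<Rightarrow> bool"
  where
  "best_embedding_constant \<Omega> e lam s p C \<longleftrightarrow>
     C > 0 \<and> embedding_inequality \<Omega> e lam s p C \<and>
     (\<forall>K. embedding_inequality \<Omega> e lam s p K \<longrightarrow> C \<le> K)"


section \<open>Time-dependent functions with values in \<open>H\<^sub>0\<^sup>s(\<Omega>)\<close>\<close>

text \<open>Bochner (strong) measurability of \<open>w : (0,T) \<rightarrow> H\<^sub>0\<^sup>s(\<Omega>)\<close>: almost everywhere a limit in
  \<open>H\<^sub>0\<^sup>s(\<Omega>)\<close> of measurable functions with finitely many values.  The library's Bochner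
  integral needs a Banach space \<^emph>\<open>type\<close>, which is not available for \<open>H\<^sub>0\<^sup>s(\<Omega>)\<close>.\<close>

definition Hs0_strongly_measurable ::
  "'a::euclidean_space set \<Rightarrow> (nat \<Rightarrow> 'a \<Rightarrow> real) \<Rightarrow> (nat \<Rightarrow> real) \<Rightarrow> real \<Rightarrow> real \<Rightarrow>
     (real \<Rightarrow> 'a \<Rightarrow> real) \<Rightarrow> bool" where
  "Hs0_strongly_measurable \<Omega> e lam s T w \<longleftrightarrow>
     (AE t in lebesgue_on {0<..<T}. w t \<in> Hs0 \<Omega> e lam s) \<and>
     (\<exists>S :: nat \<Rightarrow> real \<Rightarrow> 'a \<Rightarrow> real.
        (\<forall>k. finite (S k ` {0<..<T}) \<and> S k ` {0<..<T} \<subseteq> Hs0 \<Omega> e lam s \<and>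
             (\<forall>\<phi>. {t\<in>{0<..<T}. S k t = \<phi>} \<in> sets lebesgue)) \<and>
        (AE t in lebesgue_on {0<..<T}.
           (\<lambda>k. Hs0_norm \<Omega> e lam s (\<lambda>x. S k t x - w t x)) \<longlonglongrightarrow> 0))"

definition Linf_Hs0 ::
  "'a::euclidean_space set \<Rightarrow> (nat \<Rightarrow> 'a \<Rightarrow> real) \<Rightarrow> (nat \<Rightarrow> real) \<Rightarrow> real \<Rightarrow> real \<Rightarrow>
     (real \<Rightarrow> 'a \<Rightarrow> real) set" where
  "Linf_Hs0 \<Omega> e lam s T =
     {w. Hs0_strongly_measurable \<Omega> e lam s T w \<and>
         (\<exists>B. AE t in lebesgue_on {0<..<T}. Hs0_norm \<Omega> e lam s (w t) \<le> B)}"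

definition L2_Hs0 ::
  "'a::euclidean_space set \<Rightarrow> (nat \<Rightarrow> 'a \<Rightarrow> real) \<Rightarrow> (nat \<Rightarrow> real) \<Rightarrow> real \<Rightarrow> real \<Rightarrow>
     (real \<Rightarrow> 'a \<Rightarrow> real) set" where
  "L2_Hs0 \<Omega> e lam s T =
     {w. Hs0_strongly_measurable \<Omega> e lam s T w \<and>
         integrable (lebesgue_on {0<..<T}) (\<lambda>t. (Hs0_norm \<Omega> e lam s (w t))\<^sup>2)}"

definition test_function :: "real \<Rightarrow> (real \<Rightarrow> real) \<Rightarrow> bool" where
  "test_function T \<eta> \<longleftrightarrow>
     smooth_on UNIV \<eta> \<and> (\<exists>K. compact K \<and> K \<subseteq> {0<..<T} \<and> (\<forall>t. t \<notin> K \<longrightarrow> \<eta> t = 0))"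

text \<open>\<open>v = u\<^sub>t\<close> as weak derivative of an \<open>H\<^sub>0\<^sup>s(\<Omega>)\<close>-valued function:
  \<open>\<integral> \<eta>' u dt = - \<integral> \<eta> v dt\<close> for all test functions \<open>\<eta>\<close> on \<open>(0,T)\<close>.  The identity
  between Bochner integrals in the Hilbert space \<open>H\<^sub>0\<^sup>s(\<Omega>)\<close> is expressed by taking inner products
  with every \<open>\<nu>\<close>.\<close>

definition weak_time_derivative ::
  "'a::euclidean_space set \<Rightarrow> (nat \<Rightarrow> 'a \<Rightarrow> real) \<Rightarrow> (nat \<Rightarrow> real) \<Rightarrow> real \<Rightarrow> real \<Rightarrow>
     (real \<Rightarrow> 'a \<Rightarrow> real) \<Rightarrow> (real \<Rightarrow> 'a \<Rightarrow> real) \<Rightarrow> bool" where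
  "weak_time_derivative \<Omega> e lam s T u v \<longleftrightarrow>
     (\<forall>\<eta>. test_function T \<eta> \<longrightarrow> (\<forall>\<nu>\<in>Hs0 \<Omega> e lam s.
        (LINT t|lebesgue_on {0<..<T}. deriv \<eta> t * Hs0_inner \<Omega> e lam s (u t) \<nu>) =
        - (LINT t|lebesgue_on {0<..<T}. \<eta> t * Hs0_inner \<Omega> e lam s (v t) \<nu>)))"

definition Hs0_continuous ::
  "'a::euclidean_space set \<Rightarrow> (nat \<Rightarrow> 'a \<Rightarrow> real) \<Rightarrow> (nat \<Rightarrow> real) \<Rightarrow> real \<Rightarrow> real \<Rightarrow>
     (real \<Rightarrow> 'a \<Rightarrow> real) \<Rightarrow> bool" where
  "Hs0_continuous \<Omega> e lam s T u \<longleftrightarrow>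
     (\<forall>t\<in>{0..<T}. u t \<in> Hs0 \<Omega> e lam s \<and>
        ((\<lambda>r. Hs0_norm \<Omega> e lam s (\<lambda>x. u r x - u t x)) \<longlongrightarrow> 0) (at t within {0..<T}))"


section \<open>Weak solutions\<close>

text \<open>Weak solutions on \<open>\<Omega> \<times> [0,T)\<close> for finite \<open>T > 0\<close>.  \<open>u\<close> denotes the representative that is
  continuous in time, which is what gives a meaning to \<open>u(\<cdot>,0)\<close> and to \<open>u(t)\<close> for each \<open>t\<close>.\<close>

definition weak_solution ::
  "'a::euclidean_space set \<Rightarrow> (nat \<Rightarrow> 'a \<Rightarrow> real) \<Rightarrow> (nat \<Rightarrow> real) \<Rightarrow> real \<Rightarrow> real \<Rightarrow>
     ('a \<Rightarrow> real) \<Rightarrow> real \<Rightarrow> (real \<Rightarrow> 'a \<Rightarrow> real) \<Rightarrow> bool" where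
  "weak_solution \<Omega> e lam s p u0 T u \<longleftrightarrow>
     u \<in> Linf_Hs0 \<Omega> e lam s T \<and> Hs0_continuous \<Omega> e lam s T u \<and>
     (AE x in lebesgue_on \<Omega>. u 0 x = u0 x) \<and>
     (\<exists>ut \<in> L2_Hs0 \<Omega> e lam s T. weak_time_derivative \<Omega> e lam s T u ut \<and>
        (\<forall>\<nu>\<in>Hs0 \<Omega> e lam s. AE t in lebesgue_on {0<..<T}.
           L2_inner \<Omega> (\<lambda>x. norm x powr (- 2 * s) * ut t x) \<nu>
           + L2_inner \<Omega> (frac_lap \<Omega> e lam (s / 2) (u t)) (frac_lap \<Omega> e lam (s / 2) \<nu>)
           + L2_inner \<Omega> (frac_lap \<Omega> e lam (s / 2) (ut t)) (frac_lap \<Omega> e lam (s / 2) \<nu>)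
           = L2_inner \<Omega> (\<lambda>x. \<bar>u t x\<bar> powr (p - 2) * u t x) \<nu>))"

text \<open>Finite times \<open>T'\<close> suffice in the supremum: a solution on \<open>[0,\<infinity>)\<close> restricts to every
  finite interval.\<close>

definition max_existence_time ::
  "'a::euclidean_space set \<Rightarrow> (nat \<Rightarrow> 'a \<Rightarrow> real) \<Rightarrow> (nat \<Rightarrow> real) \<Rightarrow> real \<Rightarrow> real \<Rightarrow>
     ('a \<Rightarrow> real) \<Rightarrow> ereal" where
  "max_existence_time \<Omega> e lam s p u0 =
     (SUP T'\<in>{T'. T' > 0 \<and> (\<exists>w. weak_solution \<Omega> e lam s p u0 T' w)}. ereal T')"

text \<open>A maximal solution is only required to be a weak solution on \<open>\<Omega> \<times> [0,T')\<close> for each \<open>T' < T\<close>: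
  one that blows up at \<open>T\<close> does not belong to \<open>L\<^sup>\<infinity>(0,T;H\<^sub>0\<^sup>s(\<Omega>))\<close>.\<close>

definition maximal_weak_solution ::
  "'a::euclidean_space set \<Rightarrow> (nat \<Rightarrow> 'a \<Rightarrow> real) \<Rightarrow> (nat \<Rightarrow> real) \<Rightarrow> real \<Rightarrow> real \<Rightarrow>
     ('a \<Rightarrow> real) \<Rightarrow> ereal \<Rightarrow> (real \<Rightarrow> 'a \<Rightarrow> real) \<Rightarrow> bool" where
  "maximal_weak_solution \<Omega> e lam s p u0 T u \<longleftrightarrow>
     T = max_existence_time \<Omega> e lam s p u0 \<and>
     (\<forall>T'>0. ereal T' < T \<longrightarrow> weak_solution \<Omega> e lam s p u0 T' u)"

definition energy ::
  "'a::euclidean_space set \<Rightarrow> (nat \<Rightarrow> 'a \<Rightarrow> real) \<Rightarrow> (nat \<Rightarrow> real) \<Rightarrow> real \<Rightarrow> ('a \<Rightarrow> real) \<Rightarrow> real"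
  where
  "energy \<Omega> e lam s \<phi> =
     (LINT x|lebesgue_on \<Omega>. (\<phi> x)\<^sup>2 / norm x powr (2 * s))
     + (Lp_norm 2 \<Omega> (frac_lap \<Omega> e lam (s / 2) \<phi>))\<^sup>2"

end

theory Submission
  imports Defs
begin

text \<open>Put \<open>A(\<phi>, \<psi>) = \<integral> \<phi> \<psi> / |x|\<^sup>2\<^sup>s dx + (\<phi>, \<psi>)\<close> with the inner product of \<open>H\<^sub>0\<^sup>s\<close>, and
  let \<open>E(t) = A(u(t), u(t))\<close> be the energy.  Expanding in eigenfunctions and passing to the limit by Hardy's
  inequality turns the weak time derivative into \<open>A(u(b) - u(a), \<nu>) = \<integral> A(u\<^sub>t, \<nu>) dt\<close> over \<open>(a,b)\<close>.  With the
  fixed test function \<open>\<nu> = u(a) + u(b)\<close> the left side is \<open>E(b) - E(a)\<close>, the equation can be inserted on the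
  right, and Hoelder's and the embedding inequality give \<open>E' \<le> 2 C\<^sup>p E\<^bsup>p/2\<^esup>\<close> as a bound for the upper
  right derivative.  Comparison with solutions of \<open>y' = 2 c y\<^bsup>p/2\<^esup>\<close>, for \<open>c\<close> slightly larger than \<open>C\<^sup>p\<close>
  and blowing up slightly after \<open>T\<close>, shows that an energy below the asserted bound would stay bounded up to \<open>T\<close>.\<close>

section \<open>Smooth step functions on the real line\<close>

text \<open>Differentiating \<open>E\<close> by a product rule would pair \<open>u_t\<close> with
  the moving function \<open>u(t)\<close>. But the equation holds for almost every time only, with a
  null set depending on the test function, and \<open>u_t\<close> is known only through pairings
  with fixed elements. Hence the test function is frozen on each short interval, and the symmetry of
  \<open>A\<close> replaces the product rule. The price is an error controlled by the distance of
  \<open>u(t)\<close> from \<open>u(a)\<close>, so forward difference quotients of \<open>E\<close>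
  are bounded only up to an arbitrary \<epsilon>. This is why the comparison function must be
  strictly steeper where it meets \<open>E\<close>, which a constant above \<open>C^p\<close>
  provides. The weak derivative is formulated in the inner product of the fractional space, whereas
  \<open>A\<close> also carries the Hardy weight. Eigenfunctions bridge the two: pairing with
  \<open>e i\<close> gives the i-th coefficient times \<open>lam i powr s\<close>. The factor 2
  comes from the test function being close to \<open>2 u(a)\<close>. The linear diffusion
  contributes a nonpositive term that is discarded, and the power \<open>p/2\<close> appears because
  the fractional norm is at most \<open>sqrt E\<close>.\<close>

lemma frechet_derivative_real_1:
  fixes f :: "real \<Rightarrow> real"
  assumes "f differentiable (at x)"
  shows "frechet_derivative f (at x) 1 = deriv f x"
proof -
  have "(f has_derivative (*) (deriv f x)) (at x)"
    using assms DERIV_deriv_iff_real_differentiable has_field_derivative_def by blast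
  then show ?thesis
    by (metis frechet_derivative_at mult.right_neutral)
qed

text \<open>On the line the only basis vector is 1, so the recursion can run through
  \<open>deriv\<close>.\<close>

lemma Ck_on_Suc_real:
  fixes f :: "real \<Rightarrow> real"
  shows "Ck_on (Suc k) UNIV f \<longleftrightarrow> (\<forall>x. f differentiable (at x)) \<and> Ck_on k UNIV (deriv f)"
proof (cases "\<forall>x. f differentiable (at x)")
  case True
  then have "(\<lambda>x. frechet_derivative f (at x) 1) = deriv f"
    by (auto simp: frechet_derivative_real_1)
  with True show ?thesis by simp
qed auto

lemma Ck_on_SucI_real:
  fixes f :: "real \<Rightarrow> real"
  assumes "\<And>x. (f has_real_derivative f' x) (at x)" "Ck_on k UNIV f'"
  shows "Ck_on (Suc k) UNIV f"
proof -
  have "deriv f = f'"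
    using assms(1) by (auto intro!: DERIV_imp_deriv)
  then show ?thesis
    unfolding Ck_on_Suc_real using assms real_differentiable_def by blast
qed

lemma Ck_on_SucD_real:
  fixes f :: "real \<Rightarrow> real"
  assumes "Ck_on (Suc k) UNIV f"
  shows "(f has_real_derivative deriv f x) (at x)" "Ck_on k UNIV (deriv f)"
  using assms unfolding Ck_on_Suc_real by (simp_all add: DERIV_deriv_iff_real_differentiable)

lemma smooth_onI_real:
  fixes f :: "real \<Rightarrow> real"
  assumes "\<And>x. (f has_real_derivative f' x) (at x)" "smooth_on UNIV f'"
  shows "smooth_on UNIV f"
  unfolding smooth_on_def
proof
  fix k
  show "Ck_on k UNIV f"
  proof (cases k)
    case 0
    then show ?thesis
      using assms(1) by (auto intro!: continuous_at_imp_continuous_on DERIV_isCont)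
  next
    case (Suc j)
    then show ?thesis
      using assms Ck_on_SucI_real unfolding smooth_on_def by blast
  qed
qed

text \<open>For the product rule, where each term keeps one factor undifferentiated.\<close>

lemma Ck_on_Suc_imp_real:
  fixes f :: "real \<Rightarrow> real"
  assumes "Ck_on (Suc k) UNIV f"
  shows "Ck_on k UNIV f"
  using assms
proof (induction k arbitrary: f)
  case 0
  then show ?case
    by (metis Ck_on.simps(1) Ck_on_SucD_real(1) DERIV_isCont continuous_at_imp_continuous_on)
next
  case (Suc k)
  then show ?case
    using Ck_on_SucI_real Ck_on_SucD_real by blast
qed

lemma Ck_on_diff_real:
  fixes f g :: "real \<Rightarrow> real"
  assumes "Ck_on k UNIV f" "Ck_on k UNIV g"
  shows "Ck_on k UNIV (\<lambda>x. f x - g x)"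
  using assms
proof (induction k arbitrary: f g)
  case 0
  then show ?case by (auto intro: continuous_on_diff)
next
  case (Suc k)
  show ?case
    by (rule Ck_on_SucI_real[where f' = "\<lambda>x. deriv f x - deriv g x"])
       (use Suc Ck_on_SucD_real in \<open>auto intro!: DERIV_diff\<close>)
qed

lemma Ck_on_add_real:
  fixes f g :: "real \<Rightarrow> real"
  assumes "Ck_on k UNIV f" "Ck_on k UNIV g"
  shows "Ck_on k UNIV (\<lambda>x. f x + g x)"
  using assms
proof (induction k arbitrary: f g)
  case 0
  then show ?case by (auto intro: continuous_on_add)
next
  case (Suc k)
  show ?case
    by (rule Ck_on_SucI_real[where f' = "\<lambda>x. deriv f x + deriv g x"])
       (use Suc Ck_on_SucD_real in \<open>auto intro!: DERIV_add\<close>)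
qed

lemma Ck_on_mult_real:
  fixes f g :: "real \<Rightarrow> real"
  assumes "Ck_on k UNIV f" "Ck_on k UNIV g"
  shows "Ck_on k UNIV (\<lambda>x. f x * g x)"
  using assms
proof (induction k arbitrary: f g)
  case 0
  then show ?case by (auto intro: continuous_on_mult)
next
  case (Suc k)
  note f = Ck_on_SucD_real[OF Suc.prems(1)] Ck_on_Suc_imp_real[OF Suc.prems(1)]
  note g = Ck_on_SucD_real[OF Suc.prems(2)] Ck_on_Suc_imp_real[OF Suc.prems(2)]
  show ?case
    by (rule Ck_on_SucI_real[OF DERIV_mult[OF f(1) g(1)]]) (intro Ck_on_add_real Suc.IH f g)
qed

lemma Ck_on_const_real: "Ck_on k UNIV (\<lambda>x::real. c::real)"
proof (induction k arbitrary: c)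
  case (Suc k)
  show ?case
    by (rule Ck_on_SucI_real[where f' = "\<lambda>x. 0"]) (use Suc in auto)
qed auto

lemma Ck_on_affine_real:
  fixes f :: "real \<Rightarrow> real"
  assumes "Ck_on k UNIV f"
  shows "Ck_on k UNIV (\<lambda>x. f (c * x + d))"
  using assms
proof (induction k arbitrary: f)
  case 0
  then show ?case
    by (auto intro!: continuous_on_compose2[of UNIV f] continuous_intros)
next
  case (Suc k)
  note f = Ck_on_SucD_real[OF Suc.prems]
  have "((\<lambda>x. f (c * x + d)) has_real_derivative deriv f (c * x + d) * c) (at x)" for x
    by (rule DERIV_chain2[OF f(1)]) (auto intro!: derivative_eq_intros)
  then show ?case
    by (rule Ck_on_SucI_real) (intro Ck_on_mult_real Ck_on_const_real Suc.IH f)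
qed

text \<open>The functions \<open>P(1/x) exp(-1/x)\<close>, extended by zero, are closed under differentiation.\<close>

definition flat_exp :: "real poly \<Rightarrow> real \<Rightarrow> real" where
  "flat_exp P x = (if x > 0 then poly P (1 / x) * exp (- (1 / x)) else 0)"

lemma poly_times_exp_minus_tendsto_0:
  fixes P :: "real poly"
  shows "((\<lambda>x. poly P x * exp (- x)) \<longlongrightarrow> 0) at_top"
proof -
  have "((\<lambda>x. \<Sum>i\<le>degree P. coeff P i * (x ^ i / exp x)) \<longlongrightarrow> (\<Sum>i\<le>degree P. coeff P i * 0)) at_top"
    by (intro tendsto_sum tendsto_mult tendsto_const tendsto_power_div_exp_0)
  then show ?thesis
    by (simp add: poly_altdef exp_minus field_simps sum_divide_distrib)
qed

text \<open>For positive x the chain rule contributes the factor \<open>1/x^2\<close> and turns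
  \<open>P\<close> into \<open>P - P'\<close>, evaluated at \<open>1/x\<close>. At 0 the claim is
  that the difference quotient tends to 0, because the exponential beats every polynomial.\<close>

lemma flat_exp_DERIV:
  "(flat_exp P has_real_derivative flat_exp ([:0, 0, 1:] * (P - pderiv P)) x) (at x)"
proof -
  consider "x > 0" | "x < 0" | "x = 0" by linarith
  then show ?thesis
  proof cases
    case 1
    have "((\<lambda>x. poly P (1 / x) * exp (- (1 / x))) has_real_derivative
            flat_exp ([:0, 0, 1:] * (P - pderiv P)) x) (at x)"
      using 1 by (auto intro!: derivative_eq_intros poly_DERIV[THEN DERIV_chain2]
          simp: flat_exp_def field_simps power2_eq_square)
    then show ?thesis
      by (rule has_field_derivative_transform_within_open[where S = "{0<..}"])
         (use 1 in \<open>auto simp: flat_exp_def\<close>)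
  next
    case 2
    have "((\<lambda>x. 0) has_real_derivative flat_exp ([:0, 0, 1:] * (P - pderiv P)) x) (at x)"
      using 2 by (auto simp: flat_exp_def)
    then show ?thesis
      by (rule has_field_derivative_transform_within_open[where S = "{..<0}"])
         (use 2 in \<open>auto simp: flat_exp_def\<close>)
  next
    case 3
    \<comment> \<open>Dividing by h multiplies the polynomial in \<open>1/h\<close> by its variable,
      which is \<open>pCons 0 P\<close>.\<close>
    have "((\<lambda>h. poly (pCons 0 P) (inverse h) * exp (- inverse h)) \<longlongrightarrow> 0) (at_right 0)"
      by (rule filterlim_compose[OF poly_times_exp_minus_tendsto_0 filterlim_inverse_at_top_right])
    then have R: "((\<lambda>h. flat_exp P h / h) \<longlongrightarrow> 0) (at_right 0)"
      by (rule Lim_transform_eventually)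
         (auto simp: flat_exp_def field_simps eventually_at_right_less
               intro!: eventually_at_rightI[of 0 1])
    have L: "((\<lambda>h. flat_exp P h / h) \<longlongrightarrow> 0) (at_left 0)"
      by (rule Lim_transform_eventually[OF tendsto_const])
         (auto simp: flat_exp_def intro!: eventually_at_leftI[of "-1" 0])
    have "((\<lambda>h. flat_exp P h / h) \<longlongrightarrow> 0) (at 0)"
      by (rule filterlim_split_at_real[OF L R])
    then show ?thesis
      using 3 by (simp add: DERIV_def flat_exp_def)
  qed
qed

text \<open>The induction has to range over all \<open>P\<close> at once, since every derivative
  changes the polynomial.\<close>

lemma Ck_on_flat_exp: "Ck_on k UNIV (flat_exp P)"
proof (induction k arbitrary: P)
  case 0
  have "continuous_on UNIV (flat_exp P)"
    by (intro continuous_at_imp_continuous_on ballI DERIV_isCont[OF flat_exp_DERIV])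
  then show ?case by simp
next
  case (Suc k)
  show ?case
    by (rule Ck_on_SucI_real[OF flat_exp_DERIV Suc.IH])
qed

text \<open>The normalised antiderivative of a smooth bump supported in the unit interval.
  Differences of rescaled copies of \<open>S\<close> serve as test functions, and rescaled copies of
  its derivative \<rho> as one-sided approximate identities.\<close>

lemma smooth_step_exists:
  obtains S \<rho> :: "real \<Rightarrow> real"
  where "smooth_on UNIV S" "\<And>x. (S has_real_derivative \<rho> x) (at x)" "continuous_on UNIV \<rho>"
    "\<And>x. x \<le> 0 \<Longrightarrow> S x = 0" "\<And>x. x \<ge> 1 \<Longrightarrow> S x = 1"
    "\<And>x. x \<notin> {0..1} \<Longrightarrow> \<rho> x = 0" "\<And>x. \<bar>S x\<bar> \<le> 1"
proof -
  \<comment> \<open>The factors vanish for \<open>x \<le> 0\<close> and for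
    \<open>x \<ge> 1\<close>, so the product is positive exactly on the open unit interval. The
    argument is written in affine form for \<open>Ck_on_affine_real\<close>.\<close>
  define r where "r x = flat_exp 1 x * flat_exp 1 ((-1) * x + 1)" for x
  have r_smooth: "Ck_on k UNIV r" for k
    unfolding r_def by (intro Ck_on_mult_real Ck_on_affine_real Ck_on_flat_exp)
  have r_cont: "continuous_on UNIV r"
    using r_smooth[of 0] by simp
  have r_nonneg: "r x \<ge> 0" and r_pos: "0 < x \<Longrightarrow> x < 1 \<Longrightarrow> r x > 0"
    and r_0: "x \<notin> {0<..<1} \<Longrightarrow> r x = 0" for x
    by (auto simp: r_def flat_exp_def)
  obtain F where F: "\<And>x. (F has_real_derivative r x) (at x)"
    using einterval_antiderivative[of "-\<infinity>" "\<infinity>" r] r_cont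
    by (auto simp: continuous_on_eq_continuous_at has_real_derivative_iff_has_vector_derivative)
  have mono: "F x \<le> F y" if "x \<le> y" for x y
    using DERIV_nonneg_imp_nondecreasing[OF that] F r_nonneg by blast
  have F01: "F 0 < F 1"
    using DERIV_pos_imp_increasing_open[of 0 1 F] F r_pos
    by (meson DERIV_isCont zero_less_one continuous_at_imp_continuous_on)
  have F0: "F x = F 0" if "x \<le> 0" for x
  proof (cases "x < 0")
    case True
    obtain z where "x < z" "z < 0" "F 0 - F x = (0 - x) * r z"
      using MVT2[OF True, of F r] F by auto
    then show ?thesis using r_0[of z] by auto
  qed (use that in auto)
  have F1: "F x = F 1" if "x \<ge> 1" for x
  proof (cases "x > 1")
    case True
    obtain z where "1 < z" "z < x" "F x - F 1 = (x - 1) * r z"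
      using MVT2[OF True, of F r] F by auto
    then show ?thesis using r_0[of z] by auto
  qed (use that in auto)
  define S where "S x = (F x - F 0) / (F 1 - F 0)" for x
  define \<rho> where "\<rho> x = r x * (1 / (F 1 - F 0))" for x
  have D: "(S has_real_derivative \<rho> x) (at x)" for x
    unfolding S_def \<rho>_def using F01 by (auto intro!: derivative_eq_intros F)
  have "smooth_on UNIV \<rho>"
    unfolding smooth_on_def \<rho>_def by (intro allI Ck_on_mult_real r_smooth Ck_on_const_real)
  then have "smooth_on UNIV S"
    by (rule smooth_onI_real[OF D])
  moreover have "continuous_on UNIV \<rho>"
    unfolding \<rho>_def by (intro continuous_intros r_cont)
  moreover have "\<bar>S x\<bar> \<le> 1" for x
  proof -
    have "F 0 \<le> F x" "F x \<le> F 1"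
      using mono[of 0 x] mono[of x 1] F0[of x] F1[of x] mono[of 0 1] by (cases "x \<le> 0"; cases "x \<ge> 1"; auto)+
    then show ?thesis using F01 by (auto simp: S_def field_simps)
  qed
  ultimately show ?thesis
    using F01 D r_0 by (intro that[of S \<rho>]) (auto simp: S_def \<rho>_def dest: F0 F1)
qed


section \<open>Weak derivatives of real functions\<close>

text \<open>The substitution \<open>t = c n + \<delta> n * x\<close> moves the dependence on n from
  the kernel into \<open>g\<close>, so that \<open>M * \<bar>\<rho> x\<bar>\<close> dominates.
  Continuity is asked only on \<open>A\<close>, with all kernels supported there, because the lemma
  is applied to a function that may jump at the ends of an interval.\<close>

lemma integral_approximate_identity:
  fixes g \<rho> :: "real \<Rightarrow> real" and c \<delta> :: "nat \<Rightarrow> real"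
  assumes \<rho>: "has_bochner_integral lebesgue \<rho> 1" "\<And>x. x \<notin> {0..1} \<Longrightarrow> \<rho> x = 0"
    and g: "g \<in> borel_measurable lebesgue" "\<And>x. \<bar>g x\<bar> \<le> M" "continuous_on A g"
    and c: "\<And>n x. x \<in> {0..1} \<Longrightarrow> c n + \<delta> n * x \<in> A" "c \<longlonglongrightarrow> l" "l \<in> A"
    and \<delta>: "\<And>n. \<delta> n > 0" "\<delta> \<longlonglongrightarrow> 0"
  shows "integrable lebesgue (\<lambda>t. \<rho> ((t - c n) / \<delta> n) / \<delta> n * g t)"
    and "(\<lambda>n. \<integral>t. \<rho> ((t - c n) / \<delta> n) / \<delta> n * g t \<partial>lebesgue) \<longlonglongrightarrow> g l"
proof -
  have \<rho>_int: "integrable lebesgue \<rho>" and \<rho>_1: "integral\<^sup>L lebesgue \<rho> = 1"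
    using \<rho>(1) by (auto simp: has_bochner_integral_iff)
  have meas: "(\<lambda>x. \<rho> x * g (c n + \<delta> n * x)) \<in> borel_measurable lebesgue" for n
  proof -
    have "(\<lambda>x. c n + \<delta> n * x) \<in> lebesgue \<rightarrow>\<^sub>M lebesgue"
      using lebesgue_affine_measurable[where c = "\<lambda>x::real. \<delta> n" and t = "c n"] \<delta>(1)[of n] by simp
    from measurable_compose[OF this g(1)] show ?thesis
      using \<rho>_int by (intro borel_measurable_times) auto
  qed
  have bound: "norm (\<rho> x * g (c n + \<delta> n * x)) \<le> M * \<bar>\<rho> x\<bar>" for x n
    using mult_left_mono[OF g(2)[of "c n + \<delta> n * x"], of "\<bar>\<rho> x\<bar>"] by (simp add: abs_mult mult.commute)
  have dom: "integrable lebesgue (\<lambda>x. M * \<bar>\<rho> x\<bar>)"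
    using \<rho>_int by simp
  have int: "integrable lebesgue (\<lambda>x. \<rho> x * g (c n + \<delta> n * x))" for n
    by (rule Bochner_Integration.integrable_bound[OF dom meas])
       (use bound in \<open>auto intro!: AE_I2 intro: order_trans[OF _ abs_ge_self]\<close>)
  have eq: "(\<lambda>x. \<rho> ((c n + \<delta> n * x - c n) / \<delta> n) / \<delta> n * g (c n + \<delta> n * x))
      = (\<lambda>x. (1 / \<delta> n) * (\<rho> x * g (c n + \<delta> n * x)))" for n
    using \<delta>(1)[of n] by auto
  have "integrable lebesgue (\<lambda>x. \<rho> ((c n + \<delta> n * x - c n) / \<delta> n) / \<delta> n * g (c n + \<delta> n * x))" for n
    unfolding eq using int by simp
  then show "integrable lebesgue (\<lambda>t. \<rho> ((t - c n) / \<delta> n) / \<delta> n * g t)" for n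
    by (rule lebesgue_integrable_real_affine_iff[THEN iffD1, rotated]) (use \<delta>(1)[of n] in auto)
  have sub: "(\<integral>t. \<rho> ((t - c n) / \<delta> n) / \<delta> n * g t \<partial>lebesgue) = (\<integral>x. \<rho> x * g (c n + \<delta> n * x) \<partial>lebesgue)" for n
    using lebesgue_integral_real_affine[of "\<delta> n" "\<lambda>t. \<rho> ((t - c n) / \<delta> n) / \<delta> n * g t" "c n"] \<delta>(1)[of n]
    unfolding eq by simp
  have "(\<lambda>n. \<integral>x. \<rho> x * g (c n + \<delta> n * x) \<partial>lebesgue) \<longlonglongrightarrow> (\<integral>x. \<rho> x * g l \<partial>lebesgue)"
  proof (rule integral_dominated_convergence[OF _ meas dom])
    show "(\<lambda>x. \<rho> x * g l) \<in> borel_measurable lebesgue"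
      using \<rho>_int by auto
    show "AE x in lebesgue. (\<lambda>n. \<rho> x * g (c n + \<delta> n * x)) \<longlonglongrightarrow> \<rho> x * g l"
    proof (rule AE_I2)
      fix x :: real
      show "(\<lambda>n. \<rho> x * g (c n + \<delta> n * x)) \<longlonglongrightarrow> \<rho> x * g l"
      proof (cases "x \<in> {0..1}")
        case True
        have "(\<lambda>n. c n + \<delta> n * x) \<longlonglongrightarrow> l + 0 * x"
          by (intro tendsto_intros c \<delta>)
        then have "(\<lambda>n. g (c n + \<delta> n * x)) \<longlonglongrightarrow> g l"
          using continuous_on_tendsto_compose[OF g(3), of "\<lambda>n. c n + \<delta> n * x" l] c True by auto
        then show ?thesis by (intro tendsto_intros)
      qed (use \<rho>(2) in auto)
    qed
  qed (use bound in auto)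
  then show "(\<lambda>n. \<integral>t. \<rho> ((t - c n) / \<delta> n) / \<delta> n * g t \<partial>lebesgue) \<longlonglongrightarrow> g l"
    unfolding sub using \<rho>_1 by simp
qed

text \<open>Test functions rise from 0 to 1 just after \<open>a\<close> and fall back just before
  \<open>b\<close>. They converge to the indicator of the interval, while their derivatives converge
  to the point evaluation at \<open>a\<close> minus that at \<open>b\<close>. Both ramps lie inside
  the interval, which is why \<open>a = 0\<close> is allowed.\<close>

lemma weak_derivative_imp_integral:
  fixes G h :: "real \<Rightarrow> real"
  assumes G: "continuous_on {0..<T} G" and h: "integrable (lebesgue_on {0<..<T}) h"
    and weak: "\<And>\<eta>. test_function T \<eta> \<Longrightarrow>
      (LINT t|lebesgue_on {0<..<T}. deriv \<eta> t * G t) = - (LINT t|lebesgue_on {0<..<T}. \<eta> t * h t)"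
    and ab: "0 \<le> a" "a < b" "b < T"
  shows "G b - G a = (LINT t|lebesgue_on {a<..<b}. h t)"
proof -
  obtain S \<rho> :: "real \<Rightarrow> real" where S: "smooth_on UNIV S"
      "\<And>x. (S has_real_derivative \<rho> x) (at x)" "continuous_on UNIV \<rho>"
    and S_val: "\<And>x. x \<le> 0 \<Longrightarrow> S x = 0" "\<And>x. x \<ge> 1 \<Longrightarrow> S x = 1" "\<And>x. \<bar>S x\<bar> \<le> 1"
    and \<rho>_0: "\<And>x. x \<notin> {0..1} \<Longrightarrow> \<rho> x = 0"
    by (rule smooth_step_exists) blast
  have \<rho>_int: "has_bochner_integral lebesgue \<rho> 1"
  proof -
    have "has_bochner_integral lborel (\<lambda>x. \<rho> x * indicator {0..1} x) (S 1 - S 0)"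
      using S(2,3) by (intro has_bochner_integral_FTC_Icc_real) (auto simp: continuous_on_eq_continuous_at)
    moreover have "(\<lambda>x. \<rho> x * indicator {0..1} x) = \<rho>"
      using \<rho>_0 by (auto simp: indicator_def fun_eq_iff)
    ultimately have "has_bochner_integral lborel \<rho> 1"
      using S_val by simp
    then show ?thesis
      by (auto simp: has_bochner_integral_iff integrable_completion integral_completion
          dest: borel_measurable_integrable)
  qed
  \<comment> \<open>The 4 in the denominator gives \<open>4 * \<delta> n \<le> b - a\<close>, so the
    rising ramp from \<open>a + \<delta> n\<close> to \<open>a + 2 * \<delta> n\<close> ends before
    the falling one from \<open>b - 2 * \<delta> n\<close> to \<open>b - \<delta> n\<close>
    begins.\<close>
  define \<delta> where "\<delta> n = (b - a) / (real n + 4)" for n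
  have \<delta>_pos: "\<delta> n > 0" and \<delta>_le: "4 * \<delta> n \<le> b - a" for n
    using ab by (auto simp: \<delta>_def field_simps intro!: mult_right_mono)
  have \<delta>_lim: "\<delta> \<longlonglongrightarrow> 0"
    using LIMSEQ_ignore_initial_segment[OF lim_const_over_n[of "b - a"], of 4] by (simp add: \<delta>_def[abs_def])
  define \<eta> where "\<eta> n x = S (1 / \<delta> n * x + (- (a + \<delta> n) / \<delta> n)) - S (1 / \<delta> n * x + (- (b - 2 * \<delta> n) / \<delta> n))"
    for n x
  have \<eta>_eq: "\<eta> n x = S ((x - (a + \<delta> n)) / \<delta> n) - S ((x - (b - 2 * \<delta> n)) / \<delta> n)" for n x
    unfolding \<eta>_def using \<delta>_pos[of n]
    by (intro arg_cong2[where f = "(-)"] arg_cong[where f = S]) (auto simp: field_simps)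
  have \<eta>_deriv: "deriv (\<eta> n) x = \<rho> ((x - (a + \<delta> n)) / \<delta> n) / \<delta> n - \<rho> ((x - (b - 2 * \<delta> n)) / \<delta> n) / \<delta> n"
    for n x
    unfolding \<eta>_eq by (rule DERIV_imp_deriv)
      (use \<delta>_pos[of n] in \<open>auto intro!: derivative_eq_intros S(2)[THEN DERIV_chain2]\<close>)
  have test: "test_function T (\<eta> n)" for n
    unfolding test_function_def
  proof (intro conjI exI[where x = "{a + \<delta> n .. b - \<delta> n}"] allI impI)
    show "smooth_on UNIV (\<eta> n)"
      using S(1) unfolding smooth_on_def \<eta>_def by (intro allI Ck_on_diff_real Ck_on_affine_real) auto
    show "{a + \<delta> n..b - \<delta> n} \<subseteq> {0<..<T}"
      using ab \<delta>_pos[of n] by auto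
    fix t assume "t \<notin> {a + \<delta> n..b - \<delta> n}"
    then consider "t < a + \<delta> n" | "t > b - \<delta> n" by force
    then show "\<eta> n t = 0"
    proof cases
      case 1
      then show ?thesis
        using \<delta>_pos[of n] \<delta>_le[of n] by (simp add: \<eta>_eq S_val(1) divide_nonpos_pos)
    next
      case 2
      then have "(t - (a + \<delta> n)) / \<delta> n \<ge> 1" "(t - (b - 2 * \<delta> n)) / \<delta> n \<ge> 1"
        using \<delta>_pos[of n] \<delta>_le[of n] by (auto simp: le_divide_eq)
      then show ?thesis by (simp add: \<eta>_eq S_val(2))
    qed
  qed auto
  \<comment> \<open>\<open>G\<close> may be unbounded towards \<open>T\<close>. The cut-off is
    bounded and measurable on the whole line, as the approximate identity requires, and is still
    continuous relative to the closed interval.\<close>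
  define g where "g x = (if x \<in> {a..b} then G x else 0)" for x
  have Gab: "continuous_on {a..b} G"
    using G by (rule continuous_on_subset) (use ab in auto)
  have g_cont: "continuous_on {a..b} g"
    using Gab by (rule continuous_on_eq) (auto simp: g_def)
  obtain M where M: "\<And>x. x \<in> {a..b} \<Longrightarrow> \<bar>G x\<bar> \<le> M"
    using compact_imp_bounded[OF compact_continuous_image[OF Gab compact_Icc]]
    unfolding bounded_iff by (metis image_eqI real_norm_def)
  have g_bound: "\<bar>g x\<bar> \<le> M" for x
    using M[of x] M[of a] ab by (auto simp: g_def)
  have g_meas: "g \<in> borel_measurable lebesgue"
  proof -
    have "(\<lambda>x. indicator {a..b} x *\<^sub>R G x) \<in> borel_measurable borel"
      by (rule borel_measurable_continuous_on_indicator[OF _ Gab]) auto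
    moreover have "(\<lambda>x. indicator {a..b} x *\<^sub>R G x) = g"
      by (auto simp: g_def indicator_def)
    ultimately show ?thesis by (simp add: measurable_completion)
  qed
  have inA1: "a + \<delta> n + \<delta> n * x \<in> {a..b}" and inA2: "b - 2 * \<delta> n + \<delta> n * x \<in> {a..b}"
    if "x \<in> {0..1}" for n x
  proof -
    have "0 \<le> \<delta> n * x" "\<delta> n * x \<le> \<delta> n * 1"
      using that \<delta>_pos[of n] by (auto intro!: mult_left_mono)
    then show "a + \<delta> n + \<delta> n * x \<in> {a..b}" "b - 2 * \<delta> n + \<delta> n * x \<in> {a..b}"
      unfolding atLeastAtMost_iff using \<delta>_pos[of n] \<delta>_le[of n] by linarith+
  qed
  have "(\<lambda>n. a + \<delta> n) \<longlonglongrightarrow> a + 0" by (intro tendsto_intros \<delta>_lim)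
  then have lim1: "(\<lambda>n. a + \<delta> n) \<longlonglongrightarrow> a" by simp
  have "(\<lambda>n. b - 2 * \<delta> n) \<longlonglongrightarrow> b - 2 * 0" by (intro tendsto_intros \<delta>_lim)
  then have lim2: "(\<lambda>n. b - 2 * \<delta> n) \<longlonglongrightarrow> b" by simp
  have mem: "a \<in> {a..b}" "b \<in> {a..b}"
    using ab by auto
  note ai = integral_approximate_identity[OF \<rho>_int \<rho>_0 g_meas g_bound g_cont]
  have ai1: "integrable lebesgue (\<lambda>t. \<rho> ((t - (a + \<delta> n)) / \<delta> n) / \<delta> n * g t)"
    and ai1_lim: "(\<lambda>n. \<integral>t. \<rho> ((t - (a + \<delta> n)) / \<delta> n) / \<delta> n * g t \<partial>lebesgue) \<longlonglongrightarrow> g a" for n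
    by (rule ai[OF _ inA1 lim1 mem(1) \<delta>_pos \<delta>_lim]; assumption)+
  have ai2: "integrable lebesgue (\<lambda>t. \<rho> ((t - (b - 2 * \<delta> n)) / \<delta> n) / \<delta> n * g t)"
    and ai2_lim: "(\<lambda>n. \<integral>t. \<rho> ((t - (b - 2 * \<delta> n)) / \<delta> n) / \<delta> n * g t \<partial>lebesgue) \<longlonglongrightarrow> g b" for n
    by (rule ai[OF _ inA2 lim2 mem(2) \<delta>_pos \<delta>_lim]; assumption)+
  have "(LINT t|lebesgue_on {0<..<T}. deriv (\<eta> n) t * G t)
      = (\<integral>t. \<rho> ((t - (a + \<delta> n)) / \<delta> n) / \<delta> n * g t \<partial>lebesgue)
        - (\<integral>t. \<rho> ((t - (b - 2 * \<delta> n)) / \<delta> n) / \<delta> n * g t \<partial>lebesgue)" for n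
  proof -
    have "(LINT t|lebesgue_on {0<..<T}. deriv (\<eta> n) t * G t)
        = (\<integral>t. indicator {0<..<T} t *\<^sub>R (deriv (\<eta> n) t * G t) \<partial>lebesgue)"
      by (rule integral_restrict_space) auto
    also have "\<dots> = (\<integral>t. \<rho> ((t - (a + \<delta> n)) / \<delta> n) / \<delta> n * g t
        - \<rho> ((t - (b - 2 * \<delta> n)) / \<delta> n) / \<delta> n * g t \<partial>lebesgue)"
    proof (rule Bochner_Integration.integral_cong[OF refl])
      fix t :: real
      \<comment> \<open>Both kernels vanish outside the interval, so exchanging \<open>G\<close> for
        its cut-off \<open>g\<close> does not change the integrand.\<close>
      have "deriv (\<eta> n) t = 0" if "t \<notin> {a<..<b}"
      proof -
        have "(t - (a + \<delta> n)) / \<delta> n \<notin> {0..1}" "(t - (b - 2 * \<delta> n)) / \<delta> n \<notin> {0..1}"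
          using that \<delta>_pos[of n] \<delta>_le[of n] by (auto simp: field_simps)
        then show ?thesis by (simp add: \<eta>_deriv \<rho>_0)
      qed
      then show "indicator {0<..<T} t *\<^sub>R (deriv (\<eta> n) t * G t) = \<rho> ((t - (a + \<delta> n)) / \<delta> n) / \<delta> n * g t
        - \<rho> ((t - (b - 2 * \<delta> n)) / \<delta> n) / \<delta> n * g t"
        unfolding left_diff_distrib[symmetric] \<eta>_deriv[symmetric]
        using ab by (auto simp: g_def indicator_def)
    qed
    also have "\<dots> = (\<integral>t. \<rho> ((t - (a + \<delta> n)) / \<delta> n) / \<delta> n * g t \<partial>lebesgue)
        - (\<integral>t. \<rho> ((t - (b - 2 * \<delta> n)) / \<delta> n) / \<delta> n * g t \<partial>lebesgue)"
      by (intro Bochner_Integration.integral_diff ai1 ai2)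
    finally show ?thesis .
  qed
  then have left: "(\<lambda>n. LINT t|lebesgue_on {0<..<T}. deriv (\<eta> n) t * G t) \<longlonglongrightarrow> G a - G b"
    using tendsto_diff[OF ai1_lim ai2_lim] ab by (simp add: g_def)
  have \<eta>_lim: "(\<lambda>n. \<eta> n t) \<longlonglongrightarrow> indicator {a<..<b} t" for t
  proof -
    \<comment> \<open>The convergence is stationary at every point: the values are 0 at and beyond
      the endpoints for all n, and 1 at an interior point once both ramps have passed it.\<close>
    have "eventually (\<lambda>n. \<eta> n t = indicator {a<..<b} t) sequentially"
    proof -
      consider "t \<le> a" | "t \<ge> b" | "a < t" "t < b" by linarith
      then show ?thesis
      proof cases
        case 1
        have "(t - (a + \<delta> n)) / \<delta> n \<le> 0" "(t - (b - 2 * \<delta> n)) / \<delta> n \<le> 0" for n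
          using 1 \<delta>_pos[of n] \<delta>_le[of n] by (auto simp: divide_le_0_iff)
        then show ?thesis
          using 1 by (auto intro!: always_eventually simp: \<eta>_eq S_val(1))
      next
        case 2
        have "(t - (a + \<delta> n)) / \<delta> n \<ge> 1" "(t - (b - 2 * \<delta> n)) / \<delta> n \<ge> 1" for n
          using 2 \<delta>_pos[of n] \<delta>_le[of n] by (auto simp: le_divide_eq)
        then show ?thesis
          using 2 by (auto intro!: always_eventually simp: \<eta>_eq S_val(2))
      next
        case 3
        have "eventually (\<lambda>n. \<delta> n < min (t - a) (b - t) / 2) sequentially"
          using 3 by (intro order_tendstoD(2)[OF \<delta>_lim]) auto
        then show ?thesis
        proof eventually_elim
          case (elim n)
          then have "(t - (a + \<delta> n)) / \<delta> n \<ge> 1" "(t - (b - 2 * \<delta> n)) / \<delta> n \<le> 0"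
            using \<delta>_pos[of n] by (auto simp: le_divide_eq divide_le_0_iff)
          then show ?case
            using 3 by (simp add: \<eta>_eq S_val)
        qed
      qed
    qed
    then show ?thesis by (rule tendsto_eventually)
  qed
  have h_meas: "h \<in> borel_measurable (lebesgue_on {0<..<T})"
    using h by auto
  have "(\<lambda>n. LINT t|lebesgue_on {0<..<T}. \<eta> n t * h t)
      \<longlonglongrightarrow> (LINT t|lebesgue_on {0<..<T}. indicator {a<..<b} t * h t)"
  proof (rule integral_dominated_convergence)
    show "(\<lambda>t. indicator {a<..<b} t * h t) \<in> borel_measurable (lebesgue_on {0<..<T})"
      by (intro borel_measurable_times borel_measurable_indicator h_meas)
         (use ab in \<open>auto simp: sets_restrict_space_iff\<close>)
    show "(\<lambda>t. \<eta> n t * h t) \<in> borel_measurable (lebesgue_on {0<..<T})" for n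
    proof (rule borel_measurable_times[OF _ h_meas])
      have "continuous_on UNIV (\<eta> n)"
        using test[of n] unfolding test_function_def smooth_on_def by (metis Ck_on.simps(1))
      then show "\<eta> n \<in> borel_measurable (lebesgue_on {0<..<T})"
        by (intro measurable_restrict_space1 measurable_completion)
           (simp add: borel_measurable_continuous_onI)
    qed
    show "integrable (lebesgue_on {0<..<T}) (\<lambda>t. 2 * \<bar>h t\<bar>)"
      using h by simp
    show "AE t in lebesgue_on {0<..<T}. (\<lambda>n. \<eta> n t * h t) \<longlonglongrightarrow> indicator {a<..<b} t * h t"
      by (intro AE_I2 tendsto_intros \<eta>_lim)
    show "AE t in lebesgue_on {0<..<T}. norm (\<eta> n t * h t) \<le> 2 * \<bar>h t\<bar>" for n
    proof (rule AE_I2)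
      fix t
      have "\<bar>\<eta> n t\<bar> \<le> 2"
        unfolding \<eta>_eq using S_val(3)[of "(t - (a + \<delta> n)) / \<delta> n"] S_val(3)[of "(t - (b - 2 * \<delta> n)) / \<delta> n"]
        by linarith
      then show "norm (\<eta> n t * h t) \<le> 2 * \<bar>h t\<bar>"
        by (simp add: abs_mult mult_right_mono)
    qed
  qed
  also have "(LINT t|lebesgue_on {0<..<T}. indicator {a<..<b} t * h t)
      = (LINT t|lebesgue_on {0<..<T}. (if t \<in> {a<..<b} then h t else 0))"
    by (rule Bochner_Integration.integral_cong) (auto simp: indicator_def)
  also have "\<dots> = (LINT t|lebesgue_on {a<..<b}. h t)"
    using ab by (intro integral_restrict) auto
  finally have "(\<lambda>n. - (LINT t|lebesgue_on {0<..<T}. \<eta> n t * h t))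
      \<longlonglongrightarrow> - (LINT t|lebesgue_on {a<..<b}. h t)"
    by (rule tendsto_minus)
  with left have "G a - G b = - (LINT t|lebesgue_on {a<..<b}. h t)"
    unfolding weak[OF test] by (rule LIMSEQ_unique)
  then show ?thesis by simp
qed


section \<open>Semi-inner products on spaces of functions\<close>

text \<open>Elements are functions rather than classes, so \<open>B f f = 0\<close> does not force
  \<open>f = 0\<close>. The locale is instantiated for square-integrable functions, for the
  fractional space and for the energy form, and the laws are confined to \<open>V\<close>, where the
  integrals are meaningful.\<close>

locale semi_inner =
  fixes V :: "('x \<Rightarrow> real) set" and B :: "('x \<Rightarrow> real) \<Rightarrow> ('x \<Rightarrow> real) \<Rightarrow> real"
  assumes zero_mem: "(\<lambda>x. 0) \<in> V"
    and add_mem: "f \<in> V \<Longrightarrow> g \<in> V \<Longrightarrow> (\<lambda>x. f x + g x) \<in> V"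
    and scale_mem: "f \<in> V \<Longrightarrow> (\<lambda>x. c * f x) \<in> V"
    and sym: "f \<in> V \<Longrightarrow> g \<in> V \<Longrightarrow> B f g = B g f"
    and add_left: "f \<in> V \<Longrightarrow> g \<in> V \<Longrightarrow> h \<in> V \<Longrightarrow> B (\<lambda>x. f x + g x) h = B f h + B g h"
    and scale_left: "f \<in> V \<Longrightarrow> h \<in> V \<Longrightarrow> B (\<lambda>x. c * f x) h = c * B f h"
    and nonneg: "f \<in> V \<Longrightarrow> 0 \<le> B f f"
begin

definition nrm :: "('x \<Rightarrow> real) \<Rightarrow> real" where "nrm f = sqrt (B f f)"

lemma nrm_nonneg: "f \<in> V \<Longrightarrow> 0 \<le> nrm f"
  by (simp add: nrm_def nonneg)

lemma nrm_square: "f \<in> V \<Longrightarrow> (nrm f)\<^sup>2 = B f f"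
  by (simp add: nrm_def nonneg)

lemma diff_mem: "f \<in> V \<Longrightarrow> g \<in> V \<Longrightarrow> (\<lambda>x. f x - g x) \<in> V"
  using add_mem[of f "\<lambda>x. -1 * g x"] scale_mem[of g "-1"] by simp

lemma diff_left:
  assumes "f \<in> V" "g \<in> V" "h \<in> V"
  shows "B (\<lambda>x. f x - g x) h = B f h - B g h"
  using add_left[of f "\<lambda>x. -1 * g x" h] scale_left[of g h "-1"] scale_mem[of g "-1"] assms by simp

lemma add_right: "f \<in> V \<Longrightarrow> g \<in> V \<Longrightarrow> h \<in> V \<Longrightarrow> B h (\<lambda>x. f x + g x) = B h f + B h g"
  by (simp add: sym[of h] add_mem add_left)

lemma diff_right: "f \<in> V \<Longrightarrow> g \<in> V \<Longrightarrow> h \<in> V \<Longrightarrow> B h (\<lambda>x. f x - g x) = B h f - B h g"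
  by (simp add: sym[of h] diff_mem diff_left)

lemma scale_right: "f \<in> V \<Longrightarrow> h \<in> V \<Longrightarrow> B h (\<lambda>x. c * f x) = c * B h f"
  by (simp add: sym[of h] scale_mem scale_left)

lemma sum_mem:
  assumes "\<And>i. i \<in> I \<Longrightarrow> f i \<in> V"
  shows "(\<lambda>x. \<Sum>i\<in>I. c i * f i x) \<in> V"
  using assms
proof (induction I rule: infinite_finite_induct)
  case (insert i I)
  then show ?case
    using add_mem[OF scale_mem[of "f i" "c i"]] by simp
qed (simp_all add: zero_mem)

lemma zero_left: "h \<in> V \<Longrightarrow> B (\<lambda>x. 0) h = 0"
  using scale_left[of "\<lambda>x. 0" h 0] zero_mem by simp

lemma sum_left:
  assumes "\<And>i. i \<in> I \<Longrightarrow> f i \<in> V" "h \<in> V"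
  shows "B (\<lambda>x. \<Sum>i\<in>I. c i * f i x) h = (\<Sum>i\<in>I. c i * B (f i) h)"
  using assms
proof (induction I rule: infinite_finite_induct)
  case (insert i I)
  then show ?case
    by (simp add: add_left scale_left scale_mem sum_mem)
qed (auto simp: zero_left)

text \<open>The quadratic polynomial \<open>B (f - t g) (f - t g)\<close> in t is nonnegative. In
  the degenerate case \<open>B g g = 0\<close>, which a semi-inner product does not exclude for
  nonzero \<open>g\<close>, it is affine in t and so must be constant.\<close>

lemma Cauchy_Schwarz:
  assumes "f \<in> V" "g \<in> V"
  shows "\<bar>B f g\<bar> \<le> nrm f * nrm g"
proof -
  have quad: "0 \<le> B f f - 2 * t * B f g + t\<^sup>2 * B g g" for t
  proof -
    have "0 \<le> B (\<lambda>x. f x - t * g x) (\<lambda>x. f x - t * g x)"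
      by (intro nonneg diff_mem scale_mem assms)
    also have "\<dots> = B f f - 2 * t * B f g + t\<^sup>2 * B g g"
      using assms by (simp add: diff_left diff_right scale_left scale_right scale_mem diff_mem
          sym[of g f] power2_eq_square algebra_simps)
    finally show ?thesis .
  qed
  have "(B f g)\<^sup>2 \<le> B f f * B g g"
  proof (cases "B g g = 0")
    case True
    have "B f g = 0"
    proof (rule ccontr)
      assume "B f g \<noteq> 0"
      \<comment> \<open>At this t the affine function would take the value -1.\<close>
      then have "2 * ((B f f + 1) / (2 * B f g)) * B f g = B f f + 1"
        by simp
      with quad[of "(B f f + 1) / (2 * B f g)"] True show False by simp
    qed
    then show ?thesis using True by simp
  next
    case False
    then have "B g g > 0" using nonneg[OF assms(2)] by simp
    \<comment> \<open>This is the minimiser of the quadratic.\<close>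
    with quad[of "B f g / B g g"] show ?thesis
      by (simp add: power2_eq_square field_simps)
  qed
  then have "sqrt ((B f g)\<^sup>2) \<le> sqrt (B f f * B g g)"
    by (rule real_sqrt_le_mono)
  then show ?thesis
    by (simp add: nrm_def real_sqrt_mult)
qed

lemma nrm_triangle:
  assumes "f \<in> V" "g \<in> V"
  shows "nrm (\<lambda>x. f x + g x) \<le> nrm f + nrm g"
proof (rule power2_le_imp_le)
  have "(nrm (\<lambda>x. f x + g x))\<^sup>2 = B f f + 2 * B f g + B g g"
    using assms by (simp add: nrm_square add_mem add_left add_right sym[of g f])
  also have "\<dots> \<le> B f f + 2 * (nrm f * nrm g) + B g g"
    using Cauchy_Schwarz[OF assms] by simp
  also have "\<dots> = (nrm f + nrm g)\<^sup>2"
    using assms by (simp add: nrm_square[symmetric] power2_sum)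
  finally show "(nrm (\<lambda>x. f x + g x))\<^sup>2 \<le> (nrm f + nrm g)\<^sup>2" .
qed (simp add: nrm_nonneg assms)

lemma nrm_minus_commute: "f \<in> V \<Longrightarrow> g \<in> V \<Longrightarrow> nrm (\<lambda>x. f x - g x) = nrm (\<lambda>x. g x - f x)"
  by (simp add: nrm_def diff_left diff_right diff_mem)

lemma nrm_diff_abs_le:
  assumes "f \<in> V" "g \<in> V"
  shows "\<bar>nrm f - nrm g\<bar> \<le> nrm (\<lambda>x. f x - g x)"
  using nrm_triangle[of "\<lambda>x. f x - g x" g] nrm_triangle[of "\<lambda>x. g x - f x" f] nrm_minus_commute[of f g]
    diff_mem assms by auto

lemma tendsto_left:
  assumes "\<forall>\<^sub>F n in F. f n \<in> V" "g \<in> V" "h \<in> V" "((\<lambda>n. nrm (\<lambda>x. f n x - g x)) \<longlongrightarrow> 0) F"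
  shows "((\<lambda>n. B (f n) h) \<longlongrightarrow> B g h) F"
proof -
  have "((\<lambda>n. nrm (\<lambda>x. f n x - g x) * nrm h) \<longlongrightarrow> 0 * nrm h) F"
    by (intro tendsto_intros assms)
  then have lim: "((\<lambda>n. nrm (\<lambda>x. f n x - g x) * nrm h) \<longlongrightarrow> 0) F" by simp
  have "((\<lambda>n. B (f n) h - B g h) \<longlongrightarrow> 0) F"
  proof (rule Lim_null_comparison[OF _ lim])
    show "\<forall>\<^sub>F n in F. norm (B (f n) h - B g h) \<le> nrm (\<lambda>x. f n x - g x) * nrm h"
      using assms(1)
    proof eventually_elim
      case (elim n)
      then show ?case
        using Cauchy_Schwarz[OF diff_mem[OF elim assms(2)] assms(3)] by (simp add: diff_left assms)
    qed
  qed
  then show ?thesis by (rule Lim_null[THEN iffD2])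
qed

end

locale semi_hilbert_basis = semi_inner V B for V :: "('x \<Rightarrow> real) set" and B +
  fixes e :: "nat \<Rightarrow> 'x \<Rightarrow> real"
  assumes e_mem: "e i \<in> V"
    and e_orthonormal: "B (e i) (e j) = (if i = j then 1 else 0)"
    and e_complete: "f \<in> V \<Longrightarrow> (\<lambda>N. nrm (\<lambda>x. f x - (\<Sum>i<N. B f (e i) * e i x))) \<longlonglongrightarrow> 0"
    and V_complete: "(\<And>n. F n \<in> V) \<Longrightarrow>
      (\<And>\<epsilon>. \<epsilon> > 0 \<Longrightarrow> \<exists>N. \<forall>m\<ge>N. \<forall>n\<ge>m. B (\<lambda>x. F n x - F m x) (\<lambda>x. F n x - F m x) < \<epsilon>) \<Longrightarrow>
      \<exists>g\<in>V. (\<lambda>n::nat. nrm (\<lambda>x. g x - F n x)) \<longlonglongrightarrow> 0"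
begin

lemma series_tendsto:
  assumes "g \<in> V" "h \<in> V" "(\<lambda>N. nrm (\<lambda>x. g x - (\<Sum>i<N. c i * e i x))) \<longlonglongrightarrow> 0"
  shows "(\<lambda>i. c i * B (e i) h) sums B g h"
proof -
  have "(\<lambda>N. B (\<lambda>x. \<Sum>i<N. c i * e i x) h) \<longlonglongrightarrow> B g h"
    using assms by (intro tendsto_left) (simp_all add: nrm_minus_commute[of g] sum_mem e_mem)
  then show ?thesis
    by (simp add: sums_def sum_left e_mem assms)
qed

text \<open>This pins down the function picked by \<open>SOME\<close> in \<open>frac_lap\<close>:
  whatever the choice, its coefficients are those of the defining series.\<close>

lemma series_coefficient:
  assumes "g \<in> V" "(\<lambda>N. nrm (\<lambda>x. g x - (\<Sum>i<N. c i * e i x))) \<longlonglongrightarrow> 0"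
  shows "B g (e j) = c j"
proof -
  have "(\<lambda>i. if i = j then c i else 0) sums B g (e j)"
    using series_tendsto[OF assms(1) e_mem assms(2), of j]
    by (simp add: e_orthonormal if_distrib cong: if_cong)
  then show ?thesis
    using sums_single[of j c] sums_unique2 by blast
qed

lemma Parseval: "f \<in> V \<Longrightarrow> g \<in> V \<Longrightarrow> (\<lambda>i. B f (e i) * B g (e i)) sums B f g"
  using series_tendsto[OF _ _ e_complete] by (simp add: sym[OF e_mem])

text \<open>By orthonormality the squared distance of two partial sums is a block of the series of
  squares, so the partial sums are Cauchy.\<close>

lemma Riesz_Fischer:
  assumes "summable (\<lambda>i. (c i)\<^sup>2)"
  shows "\<exists>g\<in>V. (\<lambda>N. nrm (\<lambda>x. g x - (\<Sum>i<N. c i * e i x))) \<longlonglongrightarrow> 0"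
proof (rule V_complete)
  fix \<epsilon> :: real assume "\<epsilon> > 0"
  then obtain N where N: "\<And>m n. m \<ge> N \<Longrightarrow> norm (\<Sum>i=m..<n. (c i)\<^sup>2) < \<epsilon>"
    using assms unfolding summable_Cauchy by blast
  have "B (\<lambda>x. (\<Sum>i<n. c i * e i x) - (\<Sum>i<m. c i * e i x)) (\<lambda>x. (\<Sum>i<n. c i * e i x) - (\<Sum>i<m. c i * e i x)) < \<epsilon>"
    if "m \<ge> N" "n \<ge> m" for m n
  proof -
    let ?d = "\<lambda>x. \<Sum>i=m..<n. c i * e i x"
    have d: "(\<lambda>x. (\<Sum>i<n. c i * e i x) - (\<Sum>i<m. c i * e i x)) = ?d"
      using sum_diff_nat_ivl[of 0 m n "\<lambda>i. c i * e i x" for x] that by (auto simp: atLeast0LessThan)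
    have d_mem: "?d \<in> V" by (intro sum_mem e_mem)
    have "B ?d ?d = (\<Sum>i=m..<n. c i * (\<Sum>j=m..<n. c j * B (e j) (e i)))"
      by (simp add: sum_left e_mem d_mem sym[OF e_mem d_mem])
    also have "\<dots> = (\<Sum>i=m..<n. (c i)\<^sup>2)"
      by (intro sum.cong) (simp_all add: e_orthonormal if_distrib power2_eq_square sum.delta cong: if_cong)
    finally show ?thesis
      unfolding d using N[OF that(1), of n] by simp
  qed
  then show "\<exists>N. \<forall>m\<ge>N. \<forall>n\<ge>m. B (\<lambda>x. (\<Sum>i<n. c i * e i x) - (\<Sum>i<m. c i * e i x))
      (\<lambda>x. (\<Sum>i<n. c i * e i x) - (\<Sum>i<m. c i * e i x)) < \<epsilon>"
    by blast
qed (intro sum_mem e_mem)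

end


section \<open>Square-integrable functions\<close>

text \<open>The classical argument: a rapidly Cauchy subsequence converges almost everywhere, and
  Fatou's lemma shows that its limit is also the limit in mean square of the full sequence.\<close>

lemma (in finite_measure) square_integrable_complete:
  fixes F :: "nat \<Rightarrow> 'a \<Rightarrow> real"
  assumes F: "\<And>n. F n \<in> borel_measurable M" "\<And>n. integrable M (\<lambda>x. (F n x)\<^sup>2)"
    and Cauchy: "\<And>\<epsilon>. \<epsilon> > 0 \<Longrightarrow> \<exists>N. \<forall>m\<ge>N. \<forall>n\<ge>m. (\<integral>x. (F n x - F m x)\<^sup>2 \<partial>M) < \<epsilon>"
  shows "\<exists>g. g \<in> borel_measurable M \<and> integrable M (\<lambda>x. (g x)\<^sup>2) \<and>
    (\<lambda>n. \<integral>x. (g x - F n x)\<^sup>2 \<partial>M) \<longlonglongrightarrow> 0"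
proof -
  note [measurable] = F(1)
  have sq_add: "integrable M (\<lambda>x. (u x + v x)\<^sup>2)"
    if [measurable]: "u \<in> borel_measurable M" "v \<in> borel_measurable M"
      and "integrable M (\<lambda>x. (u x)\<^sup>2)" "integrable M (\<lambda>x. (v x)\<^sup>2)" for u v :: "'a \<Rightarrow> real"
  proof (rule Bochner_Integration.integrable_bound)
    show "integrable M (\<lambda>x. 2 * (u x)\<^sup>2 + 2 * (v x)\<^sup>2)"
      using that by simp
    have "(u x + v x)\<^sup>2 \<le> 2 * (u x)\<^sup>2 + 2 * (v x)\<^sup>2" for x
      using zero_le_power2[of "u x - v x"] by (simp add: power2_sum power2_diff)
    then show "AE x in M. norm ((u x + v x)\<^sup>2) \<le> norm (2 * (u x)\<^sup>2 + 2 * (v x)\<^sup>2)"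
      by simp
  qed simp
  have Fd: "integrable M (\<lambda>x. (F n x - F m x)\<^sup>2)" for n m
    using sq_add[of "F n" "\<lambda>x. - F m x"] F by simp
  have "\<forall>k. \<exists>N. \<forall>m\<ge>N. \<forall>n\<ge>m. (\<integral>x. (F n x - F m x)\<^sup>2 \<partial>M) < (1 / 4) ^ k"
    using Cauchy by simp
  then obtain N where N: "\<And>k m n. m \<ge> N k \<Longrightarrow> n \<ge> m \<Longrightarrow> (\<integral>x. (F n x - F m x)\<^sup>2 \<partial>M) < (1 / 4) ^ k"
    by metis
  \<comment> \<open>Adding up all earlier thresholds makes \<open>r\<close> nondecreasing with
    \<open>N k \<le> r k\<close>, and the summand \<open>k\<close> sends it to infinity.\<close>
  define r where "r k = k + (\<Sum>i\<le>k. N i)" for k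
  have r_ge: "N k \<le> r k" for k
    unfolding r_def by (rule trans_le_add2, rule member_le_sum) auto
  have r_mono: "r k \<le> r (Suc k)" for k
    by (simp add: r_def)
  define h where "h k x = \<bar>F (r (Suc k)) x - F (r k) x\<bar>" for k x
  have [measurable]: "h k \<in> borel_measurable M" for k
    unfolding h_def by measurable
  have h_bound: "(\<integral>\<^sup>+x. ennreal (h k x) \<partial>M) \<le> ennreal ((1 + measure M (space M)) * (1 / 2) ^ k)" for k
  proof -
    have int: "integrable M (\<lambda>x. 2 ^ k * (F (r (Suc k)) x - F (r k) x)\<^sup>2 + (1 / 2) ^ k)"
      using Fd by simp
    \<comment> \<open>With \<open>y = 2 ^ k * h k x\<close> this is \<open>y \<le> y^2 + 1\<close>
      divided by \<open>2 ^ k\<close>. It bounds the first moment by the second on a finite measure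
      space; the decay \<open>(1/4) ^ k\<close> of the second moment leaves
      \<open>(1/2) ^ k\<close>, which is summable.\<close>
    have "h k x \<le> 2 ^ k * (F (r (Suc k)) x - F (r k) x)\<^sup>2 + (1 / 2) ^ k" for x
    proof -
      have eq: "(1 / 2 :: real) ^ k = 1 / 2 ^ k"
        by (simp add: power_one_over)
      have "0 \<le> (2 ^ k * h k x - 1)\<^sup>2 + 2 ^ k * h k x" by (simp add: h_def)
      then have "2 ^ k * h k x \<le> (2 ^ k * h k x)\<^sup>2 + 1"
        by (simp add: power2_diff mult.commute)
      then have "2 ^ k * h k x / 2 ^ k \<le> ((2 ^ k * h k x)\<^sup>2 + 1) / 2 ^ k"
        by (rule divide_right_mono) simp
      then show ?thesis
        unfolding eq by (simp add: h_def power_mult_distrib add_divide_distrib power2_eq_square[of "2 ^ k"])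
    qed
    then have "(\<integral>\<^sup>+x. ennreal (h k x) \<partial>M)
        \<le> (\<integral>\<^sup>+x. ennreal (2 ^ k * (F (r (Suc k)) x - F (r k) x)\<^sup>2 + (1 / 2) ^ k) \<partial>M)"
      by (intro nn_integral_mono ennreal_leI)
    also have "\<dots> = ennreal (\<integral>x. 2 ^ k * (F (r (Suc k)) x - F (r k) x)\<^sup>2 + (1 / 2) ^ k \<partial>M)"
      using int by (rule nn_integral_eq_integral) simp
    also have "\<dots> \<le> ennreal ((1 + measure M (space M)) * (1 / 2) ^ k)"
    proof (rule ennreal_leI)
      have eq: "2 ^ k * (1 / 4 :: real) ^ k = (1 / 2) ^ k"
        by (simp flip: power_mult_distrib)
      have "2 ^ k * (\<integral>x. (F (r (Suc k)) x - F (r k) x)\<^sup>2 \<partial>M) \<le> 2 ^ k * (1 / 4) ^ k"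
        using N[OF r_ge r_mono] by (intro mult_left_mono) (auto intro: less_imp_le)
      then show "(\<integral>x. 2 ^ k * (F (r (Suc k)) x - F (r k) x)\<^sup>2 + (1 / 2) ^ k \<partial>M)
          \<le> (1 + measure M (space M)) * (1 / 2) ^ k"
        using Fd by (simp add: eq algebra_simps)
    qed
    finally show ?thesis .
  qed
  have "(\<integral>\<^sup>+x. (\<Sum>k. ennreal (h k x)) \<partial>M) = (\<Sum>k. \<integral>\<^sup>+x. ennreal (h k x) \<partial>M)"
    by (intro nn_integral_suminf) simp
  also have "\<dots> \<le> (\<Sum>k. ennreal ((1 + measure M (space M)) * (1 / 2) ^ k))"
    by (intro suminf_le h_bound) auto
  also have "\<dots> = ennreal (\<Sum>k. (1 + measure M (space M)) * (1 / 2) ^ k)"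
    by (intro suminf_ennreal2 summable_mult summable_geometric) auto
  finally have "(\<integral>\<^sup>+x. (\<Sum>k. ennreal (h k x)) \<partial>M)
      \<le> ennreal (\<Sum>k. (1 + measure M (space M)) * (1 / 2) ^ k)" .
  then have "(\<integral>\<^sup>+x. (\<Sum>k. ennreal (h k x)) \<partial>M) \<noteq> \<infinity>"
    using neq_top_trans[OF ennreal_neq_top] by (simp add: infinity_ennreal_def)
  then have fin: "AE x in M. (\<Sum>k. ennreal (h k x)) \<noteq> \<infinity>"
    by (intro nn_integral_noteq_infinite) auto
  \<comment> \<open>Taking \<open>lim\<close> at every point makes \<open>g\<close> measurable
    outright; it is the actual limit almost everywhere.\<close>
  define g where "g x = lim (\<lambda>k. F (r k) x)" for x
  have [measurable]: "g \<in> borel_measurable M"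
    unfolding g_def by measurable
  have conv: "AE x in M. (\<lambda>k. F (r k) x) \<longlonglongrightarrow> g x"
    using fin
  proof eventually_elim
    case (elim x)
    then have "summable (\<lambda>k. \<bar>F (r (Suc k)) x - F (r k) x\<bar>)"
      unfolding h_def by (intro summable_suminf_not_top) auto
    then have "summable (\<lambda>k. F (r (Suc k)) x - F (r k) x)"
      by (rule summable_rabs_cancel)
    then have "convergent (\<lambda>n. \<Sum>k<n. F (r (Suc k)) x - F (r k) x)"
      by (simp add: summable_iff_convergent)
    then have "convergent (\<lambda>n. F (r n) x - F (r 0) x)"
      by (simp add: sum_lessThan_telescope[of "\<lambda>k. F (r k) x"])
    then have "convergent (\<lambda>n. F (r n) x)"
      by (simp add: convergent_diff_const_right_iff)
    then show ?case
      unfolding g_def by (simp add: convergent_LIMSEQ_iff)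
  qed
  \<comment> \<open>Fatou along the subsequence: if all later terms are within \<epsilon> of
    \<open>F n\<close>, then so is \<open>g\<close>. Integrability of the difference comes from the
    same bound.\<close>
  have g_close: "integrable M (\<lambda>x. (g x - F n x)\<^sup>2) \<and> (\<integral>x. (g x - F n x)\<^sup>2 \<partial>M) \<le> \<epsilon>"
    if \<epsilon>: "\<epsilon> > 0" and n: "\<forall>m\<ge>n. (\<integral>x. (F m x - F n x)\<^sup>2 \<partial>M) \<le> \<epsilon>" for n \<epsilon>
  proof -
    have "(\<integral>\<^sup>+x. ennreal ((g x - F n x)\<^sup>2) \<partial>M) = (\<integral>\<^sup>+x. liminf (\<lambda>k. ennreal ((F (r k) x - F n x)\<^sup>2)) \<partial>M)"
    proof (intro nn_integral_cong_AE)
      show "AE x in M. ennreal ((g x - F n x)\<^sup>2) = liminf (\<lambda>k. ennreal ((F (r k) x - F n x)\<^sup>2))"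
        using conv
      proof eventually_elim
        case (elim x)
        then have "(\<lambda>k. ennreal ((F (r k) x - F n x)\<^sup>2)) \<longlonglongrightarrow> ennreal ((g x - F n x)\<^sup>2)"
          by (intro tendsto_intros)
        then show ?case
          using lim_imp_Liminf[OF trivial_limit_sequentially] by metis
      qed
    qed
    also have "\<dots> \<le> liminf (\<lambda>k. \<integral>\<^sup>+x. ennreal ((F (r k) x - F n x)\<^sup>2) \<partial>M)"
      by (intro nn_integral_liminf) simp
    also have "\<dots> \<le> limsup (\<lambda>k. \<integral>\<^sup>+x. ennreal ((F (r k) x - F n x)\<^sup>2) \<partial>M)"
      by (intro Liminf_le_Limsup) simp
    also have "\<dots> \<le> ennreal \<epsilon>"
    proof (intro Limsup_bounded)
      show "\<forall>\<^sub>F k in sequentially. (\<integral>\<^sup>+x. ennreal ((F (r k) x - F n x)\<^sup>2) \<partial>M) \<le> ennreal \<epsilon>"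
        using eventually_ge_at_top[of n]
      proof eventually_elim
        case (elim k)
        then have "n \<le> r k"
          by (simp add: r_def)
        then show ?case
          using n Fd by (auto simp: nn_integral_eq_integral intro!: ennreal_leI)
      qed
    qed
    finally have le: "(\<integral>\<^sup>+x. ennreal ((g x - F n x)\<^sup>2) \<partial>M) \<le> ennreal \<epsilon>" .
    then have "integrable M (\<lambda>x. (g x - F n x)\<^sup>2)"
      by (intro integrableI_bounded) (auto intro: le_less_trans)
    then show ?thesis
      using le \<epsilon> by (simp add: nn_integral_eq_integral)
  qed
  have eventually_le: "\<exists>N. \<forall>n\<ge>N. integrable M (\<lambda>x. (g x - F n x)\<^sup>2) \<and> (\<integral>x. (g x - F n x)\<^sup>2 \<partial>M) \<le> \<epsilon>"
    if \<epsilon>: "\<epsilon> > 0" for \<epsilon>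
  proof -
    obtain N0 where "\<And>m n. m \<ge> N0 \<Longrightarrow> n \<ge> m \<Longrightarrow> (\<integral>x. (F n x - F m x)\<^sup>2 \<partial>M) < \<epsilon>"
      using Cauchy[OF \<epsilon>] by blast
    then show ?thesis
      by (intro exI[of _ N0] allI impI g_close \<epsilon>) (auto intro: less_imp_le)
  qed
  then obtain n where "integrable M (\<lambda>x. (g x - F n x)\<^sup>2)"
    using zero_less_one by blast
  then have "integrable M (\<lambda>x. (g x)\<^sup>2)"
    using sq_add[of "\<lambda>x. g x - F n x" "F n"] F by simp
  moreover have "(\<lambda>n. \<integral>x. (g x - F n x)\<^sup>2 \<partial>M) \<longlonglongrightarrow> 0"
  proof (rule LIMSEQ_I)
    fix \<epsilon> :: real assume "\<epsilon> > 0"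
    then obtain N where "\<forall>n\<ge>N. (\<integral>x. (g x - F n x)\<^sup>2 \<partial>M) \<le> \<epsilon> / 2"
      using eventually_le[of "\<epsilon> / 2"] by auto
    then show "\<exists>N. \<forall>n\<ge>N. norm ((\<integral>x. (g x - F n x)\<^sup>2 \<partial>M) - 0) < \<epsilon>"
      using \<open>\<epsilon> > 0\<close> by (intro exI[of _ N]) (fastforce simp: integral_nonneg_AE)
  qed
  ultimately show ?thesis
    by (intro exI[of _ g]) simp
qed


section \<open>Square-integrable functions as a semi-inner product space\<close>

lemma Lp_space_2_iff:
  "f \<in> Lp_space 2 \<Omega> \<longleftrightarrow>
    f \<in> borel_measurable (lebesgue_on \<Omega>) \<and> integrable (lebesgue_on \<Omega>) (\<lambda>x. (f x)\<^sup>2)"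
  by (simp add: Lp_space_def)

lemma Lp_norm_2_eq: "Lp_norm 2 \<Omega> f = sqrt (L2_inner \<Omega> f f)"
  by (simp add: Lp_norm_def L2_inner_def powr_half_sqrt integral_nonneg_AE flip: power2_eq_square)

text \<open>Used with the weight 1 and with the Hardy weight; the bound is
  \<open>\<bar>f g\<bar> \<le> f^2 + g^2\<close>.\<close>

lemma integrable_mult_weight:
  fixes f g w :: "'b \<Rightarrow> real"
  assumes [measurable]: "f \<in> borel_measurable M" "g \<in> borel_measurable M" "w \<in> borel_measurable M"
    and "\<And>x. w x \<ge> 0"
    and "integrable M (\<lambda>x. w x * (f x)\<^sup>2)" "integrable M (\<lambda>x. w x * (g x)\<^sup>2)"
  shows "integrable M (\<lambda>x. w x * (f x * g x))"
proof (rule Bochner_Integration.integrable_bound)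
  show "integrable M (\<lambda>x. w x * (f x)\<^sup>2 + w x * (g x)\<^sup>2)"
    using assms by simp
  show "AE x in M. norm (w x * (f x * g x)) \<le> norm (w x * (f x)\<^sup>2 + w x * (g x)\<^sup>2)"
  proof (rule AE_I2)
    fix x
    have "\<bar>f x * g x\<bar> \<le> (f x)\<^sup>2 + (g x)\<^sup>2"
      using zero_le_power2[of "f x - g x"] zero_le_power2[of "f x + g x"]
      by (simp add: power2_sum power2_diff abs_le_iff)
    then have "w x * \<bar>f x * g x\<bar> \<le> w x * ((f x)\<^sup>2 + (g x)\<^sup>2)"
      using assms(4) by (rule mult_left_mono)
    then show "norm (w x * (f x * g x)) \<le> norm (w x * (f x)\<^sup>2 + w x * (g x)\<^sup>2)"
      using assms(4)[of x] by (simp add: abs_mult distrib_left)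
  qed
qed simp

lemma L2_mult_integrable:
  assumes "f \<in> Lp_space 2 \<Omega>" "g \<in> Lp_space 2 \<Omega>"
  shows "integrable (lebesgue_on \<Omega>) (\<lambda>x. f x * g x)"
  using integrable_mult_weight[of f "lebesgue_on \<Omega>" g "\<lambda>x. 1"] assms by (simp add: Lp_space_2_iff)

lemma semi_inner_L2: "semi_inner (Lp_space 2 \<Omega>) (L2_inner \<Omega>)"
proof
  fix f g :: "'a \<Rightarrow> real" assume fg: "f \<in> Lp_space 2 \<Omega>" "g \<in> Lp_space 2 \<Omega>"
  have "(\<lambda>x. (f x + g x)\<^sup>2) = (\<lambda>x. (f x)\<^sup>2 + 2 * (f x * g x) + (g x)\<^sup>2)"
    by (simp add: power2_sum algebra_simps)
  then show "(\<lambda>x. f x + g x) \<in> Lp_space 2 \<Omega>"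
    using fg L2_mult_integrable[OF fg] by (simp add: Lp_space_2_iff borel_measurable_add)
  show "L2_inner \<Omega> f g = L2_inner \<Omega> g f"
    by (simp add: L2_inner_def mult.commute)
next
  fix f g h :: "'a \<Rightarrow> real" assume "f \<in> Lp_space 2 \<Omega>" "g \<in> Lp_space 2 \<Omega>" "h \<in> Lp_space 2 \<Omega>"
  then show "L2_inner \<Omega> (\<lambda>x. f x + g x) h = L2_inner \<Omega> f h + L2_inner \<Omega> g h"
    by (simp add: L2_inner_def distrib_right L2_mult_integrable)
qed (auto simp: Lp_space_2_iff L2_inner_def power_mult_distrib mult.assoc integral_nonneg_AE)

lemma nrm_L2: "semi_inner.nrm (L2_inner \<Omega>) = Lp_norm 2 \<Omega>"
  by (rule ext) (simp add: semi_inner.nrm_def[OF semi_inner_L2] Lp_norm_2_eq)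


section \<open>The spaces of the spectral fractional Laplacian\<close>

locale dirichlet_system =
  fixes \<Omega> :: "'a::euclidean_space set" and e :: "nat \<Rightarrow> 'a \<Rightarrow> real" and lam :: "nat \<Rightarrow> real"
    and s :: real
  assumes open_dom: "open \<Omega>" and bounded_dom: "bounded \<Omega>"
    and eigensystem: "dirichlet_eigensystem \<Omega> e lam"
begin

lemma finite_measure_dom: "finite_measure (lebesgue_on \<Omega>)"
  by (intro finite_measure_lebesgue_on lmeasurable_open bounded_dom open_dom)

text \<open>Orthonormality is stated through integrals, which does not by itself give square
  integrability. That follows here from continuity on the compact closure of the bounded
  domain.\<close>

lemma eigenfunction_L2: "e i \<in> Lp_space 2 \<Omega>"
proof -
  interpret finite_measure "lebesgue_on \<Omega>" by (rule finite_measure_dom)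
  have cont: "continuous_on (closure \<Omega>) (e i)"
    using eigensystem by (simp add: dirichlet_eigensystem_def)
  then have meas: "e i \<in> borel_measurable (lebesgue_on \<Omega>)"
    using open_dom by (intro continuous_imp_measurable_on_sets_lebesgue
        continuous_on_subset[OF cont closure_subset]) auto
  have "compact (closure \<Omega>)"
    using bounded_dom by simp
  from compact_imp_bounded[OF compact_continuous_image[OF cont this]]
  obtain M where "\<forall>y\<in>e i ` closure \<Omega>. norm y \<le> M"
    unfolding bounded_iff by blast
  then have "\<bar>e i x\<bar> \<le> M" if "x \<in> \<Omega>" for x
    using that closure_subset by fastforce
  then have "AE x in lebesgue_on \<Omega>. norm ((e i x)\<^sup>2) \<le> M\<^sup>2"
    by (intro AE_I2) (simp add: abs_le_square_iff[symmetric] order_trans[OF _ abs_ge_self])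
  then have "integrable (lebesgue_on \<Omega>) (\<lambda>x. (e i x)\<^sup>2)"
    using meas by (intro integrable_const_bound) auto
  then show ?thesis
    using meas by (simp add: Lp_space_2_iff)
qed

sublocale L2: semi_hilbert_basis "Lp_space 2 \<Omega>" "L2_inner \<Omega>" e
proof -
  interpret finite_measure "lebesgue_on \<Omega>" by (rule finite_measure_dom)
  interpret semi_inner "Lp_space 2 \<Omega>" "L2_inner \<Omega>" by (rule semi_inner_L2)
  show "semi_hilbert_basis (Lp_space 2 \<Omega>) (L2_inner \<Omega>) e"
  proof
    fix F :: "nat \<Rightarrow> 'a \<Rightarrow> real"
    assume F: "\<And>n. F n \<in> Lp_space 2 \<Omega>"
      and C: "\<And>\<epsilon>. \<epsilon> > 0 \<Longrightarrow> \<exists>N. \<forall>m\<ge>N. \<forall>n\<ge>m. L2_inner \<Omega> (\<lambda>x. F n x - F m x) (\<lambda>x. F n x - F m x) < \<epsilon>"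
    have "\<exists>g. g \<in> borel_measurable (lebesgue_on \<Omega>) \<and> integrable (lebesgue_on \<Omega>) (\<lambda>x. (g x)\<^sup>2) \<and>
        (\<lambda>n. \<integral>x. (g x - F n x)\<^sup>2 \<partial>(lebesgue_on \<Omega>)) \<longlonglongrightarrow> 0"
      using F C by (intro square_integrable_complete) (simp_all add: Lp_space_2_iff L2_inner_def power2_eq_square)
    then obtain g where g: "g \<in> Lp_space 2 \<Omega>" "(\<lambda>n. L2_inner \<Omega> (\<lambda>x. g x - F n x) (\<lambda>x. g x - F n x)) \<longlonglongrightarrow> 0"
      by (auto simp: Lp_space_2_iff L2_inner_def power2_eq_square)
    then have "(\<lambda>n. nrm (\<lambda>x. g x - F n x)) \<longlonglongrightarrow> 0"
      unfolding nrm_def using tendsto_real_sqrt[OF g(2)] by simp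
    with g(1) show "\<exists>g\<in>Lp_space 2 \<Omega>. (\<lambda>n. nrm (\<lambda>x. g x - F n x)) \<longlonglongrightarrow> 0" by blast
  qed (use eigensystem eigenfunction_L2 in \<open>auto simp: dirichlet_eigensystem_def nrm_L2\<close>)
qed

abbreviation coef :: "('a \<Rightarrow> real) \<Rightarrow> nat \<Rightarrow> real" where
  "coef \<phi> i \<equiv> L2_inner \<Omega> \<phi> (e i)"

abbreviation H :: "('a \<Rightarrow> real) set" where "H \<equiv> Hs0 \<Omega> e lam s"
abbreviation H_inner :: "('a \<Rightarrow> real) \<Rightarrow> ('a \<Rightarrow> real) \<Rightarrow> real" where "H_inner \<equiv> Hs0_inner \<Omega> e lam s"
abbreviation H_norm :: "('a \<Rightarrow> real) \<Rightarrow> real" where "H_norm \<equiv> Hs0_norm \<Omega> e lam s"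

lemma Hs0_iff: "\<phi> \<in> H \<longleftrightarrow> \<phi> \<in> Lp_space 2 \<Omega> \<and> summable (\<lambda>i. (coef \<phi> i)\<^sup>2 * lam i powr s)"
  by (simp add: Hs0_def)

lemma powr_half_square: "(lam i powr (s / 2))\<^sup>2 = lam i powr s"
  by (simp add: power2_eq_square flip: powr_add)

text \<open>Riesz-Fischer shows that the \<open>SOME\<close> in \<open>frac_lap\<close> has a
  witness, so the chosen function really is a sum of the series.\<close>

lemma frac_lap_half:
  assumes "\<phi> \<in> H"
  shows "frac_lap \<Omega> e lam (s / 2) \<phi> \<in> Lp_space 2 \<Omega>"
    and "coef (frac_lap \<Omega> e lam (s / 2) \<phi>) i = coef \<phi> i * lam i powr (s / 2)"
proof -
  have "summable (\<lambda>i. (coef \<phi> i * lam i powr (s / 2))\<^sup>2)"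
    using assms by (simp add: Hs0_iff power_mult_distrib powr_half_square)
  from L2.Riesz_Fischer[OF this]
  have "\<exists>g. g \<in> Lp_space 2 \<Omega> \<and>
      (\<lambda>N. Lp_norm 2 \<Omega> (\<lambda>x. g x - (\<Sum>i<N. coef \<phi> i * lam i powr (s / 2) * e i x))) \<longlonglongrightarrow> 0"
    by (auto simp: nrm_L2)
  from someI_ex[OF this]
  have *: "frac_lap \<Omega> e lam (s / 2) \<phi> \<in> Lp_space 2 \<Omega>"
    "(\<lambda>N. L2.nrm (\<lambda>x. frac_lap \<Omega> e lam (s / 2) \<phi> x
        - (\<Sum>i<N. coef \<phi> i * lam i powr (s / 2) * e i x))) \<longlonglongrightarrow> 0"
    unfolding frac_lap_def[symmetric] nrm_L2 by auto
  show "frac_lap \<Omega> e lam (s / 2) \<phi> \<in> Lp_space 2 \<Omega>"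
    by (rule *)
  show "coef (frac_lap \<Omega> e lam (s / 2) \<phi>) i = coef \<phi> i * lam i powr (s / 2)"
    by (rule L2.series_coefficient[OF *])
qed

text \<open>Since \<open>frac_lap\<close> is a choice of representative, it need not be linear
  pointwise. Parseval removes the choice: the inner product depends on coefficients only, and its
  bilinearity is then read off from this series.\<close>

lemma Hs0_inner_sums:
  assumes "\<phi> \<in> H" "\<psi> \<in> H"
  shows "(\<lambda>i. coef \<phi> i * coef \<psi> i * lam i powr s) sums H_inner \<phi> \<psi>"
proof -
  have eq: "coef \<phi> i * lam i powr (s / 2) * (coef \<psi> i * lam i powr (s / 2)) = coef \<phi> i * coef \<psi> i * lam i powr s" for i
    by (simp add: powr_half_square[symmetric] power2_eq_square)
  show ?thesis
    using L2.Parseval[OF frac_lap_half(1)[OF assms(1)] frac_lap_half(1)[OF assms(2)]]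
    unfolding frac_lap_half(2)[OF assms(1)] frac_lap_half(2)[OF assms(2)] eq Hs0_inner_def .
qed

lemma Hs0_L2: "\<phi> \<in> H \<Longrightarrow> \<phi> \<in> Lp_space 2 \<Omega>"
  by (simp add: Hs0_iff)

lemma Hs0_scale:
  assumes "f \<in> H"
  shows "(\<lambda>x. c * f x) \<in> H"
proof -
  have "summable (\<lambda>i. c\<^sup>2 * ((coef f i)\<^sup>2 * lam i powr s))"
    using assms by (intro summable_mult) (simp add: Hs0_iff)
  then show ?thesis
    using assms
    by (simp add: Hs0_iff L2.scale_mem L2.scale_left eigenfunction_L2 power_mult_distrib mult.assoc)
qed

lemma Hs0_add:
  assumes "f \<in> H" "g \<in> H"
  shows "(\<lambda>x. f x + g x) \<in> H"
proof -
  have "summable (\<lambda>i. (coef f i + coef g i)\<^sup>2 * lam i powr s)"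
  proof (rule summable_comparison_test')
    show "summable (\<lambda>i. 2 * ((coef f i)\<^sup>2 * lam i powr s) + 2 * ((coef g i)\<^sup>2 * lam i powr s))"
      using assms by (intro summable_add summable_mult) (simp_all add: Hs0_iff)
    fix i :: nat
    have "(coef f i + coef g i)\<^sup>2 \<le> 2 * (coef f i)\<^sup>2 + 2 * (coef g i)\<^sup>2"
      using zero_le_power2[of "coef f i - coef g i"] by (simp add: power2_sum power2_diff)
    then have "(coef f i + coef g i)\<^sup>2 * lam i powr s
        \<le> (2 * (coef f i)\<^sup>2 + 2 * (coef g i)\<^sup>2) * lam i powr s"
      by (rule mult_right_mono) simp
    then show "norm ((coef f i + coef g i)\<^sup>2 * lam i powr s)
        \<le> 2 * ((coef f i)\<^sup>2 * lam i powr s) + 2 * ((coef g i)\<^sup>2 * lam i powr s)"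
      by (simp add: algebra_simps)
  qed
  then show ?thesis
    using assms by (simp add: Hs0_iff L2.add_mem L2.add_left eigenfunction_L2)
qed

sublocale H: semi_inner H H_inner
proof
  show "(\<lambda>x. 0) \<in> H"
    by (simp add: Hs0_iff L2.zero_mem L2.zero_left eigenfunction_L2)
next
  fix f g assume fg: "f \<in> H" "g \<in> H"
  show "H_inner f g = H_inner g f"
    by (simp add: Hs0_inner_def L2.sym frac_lap_half fg)
next
  fix f assume "f \<in> H"
  then show "0 \<le> H_inner f f"
    by (simp add: Hs0_inner_def L2.nonneg frac_lap_half)
next
  fix f h c assume fh: "f \<in> H" "h \<in> H"
  have "(\<lambda>i. c * (coef f i * coef h i * lam i powr s)) sums (c * H_inner f h)"
    by (intro sums_mult Hs0_inner_sums fh)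
  moreover have "(\<lambda>i. c * (coef f i * coef h i * lam i powr s)) sums H_inner (\<lambda>x. c * f x) h"
    using Hs0_inner_sums[OF Hs0_scale[OF fh(1)] fh(2), of c] fh
    by (simp add: L2.scale_left Hs0_L2 eigenfunction_L2 mult.assoc)
  ultimately show "H_inner (\<lambda>x. c * f x) h = c * H_inner f h"
    using sums_unique2 by blast
next
  fix f g h assume *: "f \<in> H" "g \<in> H" "h \<in> H"
  have "(\<lambda>i. coef f i * coef h i * lam i powr s + coef g i * coef h i * lam i powr s)
      sums (H_inner f h + H_inner g h)"
    by (intro sums_add Hs0_inner_sums *)
  moreover have "(\<lambda>i. coef f i * coef h i * lam i powr s + coef g i * coef h i * lam i powr s)
      sums H_inner (\<lambda>x. f x + g x) h"
    using Hs0_inner_sums[OF Hs0_add[OF *(1,2)] *(3)] *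
    by (simp add: L2.add_left Hs0_L2 eigenfunction_L2 distrib_right)
  ultimately show "H_inner (\<lambda>x. f x + g x) h = H_inner f h + H_inner g h"
    using sums_unique2 by blast
qed (auto intro: Hs0_add Hs0_scale)

lemma nrm_Hs0: "H.nrm = H_norm"
  by (rule ext) (simp add: H.nrm_def Hs0_norm_def Hs0_inner_def Lp_norm_2_eq)

lemma eigenfunction_Hs0: "e i \<in> H"
proof -
  have "summable (\<lambda>j. (coef (e i) j)\<^sup>2 * lam j powr s)"
    by (rule summable_finite[of "{i}"]) (auto simp: L2.e_orthonormal)
  then show ?thesis
    by (simp add: Hs0_iff eigenfunction_L2)
qed

text \<open>The link between pairings in \<open>H\<close>, in which the weak time derivative is
  formulated, and the coefficients of the eigenfunction expansion.\<close>

lemma Hs0_inner_eigenfunction: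
  assumes "\<phi> \<in> H"
  shows "H_inner \<phi> (e i) = coef \<phi> i * lam i powr s"
proof -
  have eq: "coef \<phi> j * coef (e i) j * lam j powr s = (if j = i then coef \<phi> j * lam j powr s else 0)" for j
    by (simp add: L2.e_orthonormal)
  have "(\<lambda>j. if j = i then coef \<phi> j * lam j powr s else 0) sums H_inner \<phi> (e i)"
    using Hs0_inner_sums[OF assms eigenfunction_Hs0, of i] unfolding eq .
  then show ?thesis
    using sums_single[of i "\<lambda>j. coef \<phi> j * lam j powr s"] sums_unique2 by blast
qed

definition proj :: "nat \<Rightarrow> ('a \<Rightarrow> real) \<Rightarrow> 'a \<Rightarrow> real" where
  "proj N \<phi> x = (\<Sum>i<N. coef \<phi> i * e i x)"

lemma proj_Hs0: "proj N \<phi> \<in> H"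
  unfolding proj_def[abs_def] by (intro H.sum_mem eigenfunction_Hs0)

text \<open>The two values agree, so \<open>proj N\<close> is an orthogonal projection in
  \<open>H\<close> as well, and its squared error is the tail of the series.\<close>

lemma Hs0_inner_proj:
  assumes "\<phi> \<in> H"
  shows "H_inner (proj N \<phi>) \<phi> = (\<Sum>i<N. (coef \<phi> i)\<^sup>2 * lam i powr s)"
    and "H_inner (proj N \<phi>) (proj N \<phi>) = (\<Sum>i<N. (coef \<phi> i)\<^sup>2 * lam i powr s)"
proof -
  have coef: "coef (proj N \<phi>) i = coef \<phi> i" if "i < N" for i
    using that unfolding proj_def[abs_def]
    by (simp add: L2.sum_left eigenfunction_L2 L2.e_orthonormal if_distrib sum.delta cong: if_cong)
  have *: "H_inner (proj N \<phi>) \<psi> = (\<Sum>i<N. coef \<phi> i * (coef \<psi> i * lam i powr s))" if "\<psi> \<in> H" for \<psi>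
    using that unfolding proj_def[abs_def]
    by (simp add: H.sum_left eigenfunction_Hs0 H.sym[OF eigenfunction_Hs0] Hs0_inner_eigenfunction)
  show "H_inner (proj N \<phi>) \<phi> = (\<Sum>i<N. (coef \<phi> i)\<^sup>2 * lam i powr s)"
    using assms by (simp add: * power2_eq_square mult.assoc)
  show "H_inner (proj N \<phi>) (proj N \<phi>) = (\<Sum>i<N. (coef \<phi> i)\<^sup>2 * lam i powr s)"
    by (simp add: * proj_Hs0 coef power2_eq_square mult.assoc)
qed

lemma Hs0_inner_self_sums: "\<phi> \<in> H \<Longrightarrow> (\<lambda>i. (coef \<phi> i)\<^sup>2 * lam i powr s) sums H_inner \<phi> \<phi>"
  using Hs0_inner_sums[of \<phi> \<phi>] by (simp add: power2_eq_square)

text \<open>Bessel's inequality in \<open>H\<close>; it supplies a domination that is uniform in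
  \<open>N\<close>.\<close>

lemma proj_norm_le:
  assumes "\<phi> \<in> H"
  shows "H.nrm (proj N \<phi>) \<le> H.nrm \<phi>"
proof -
  have "(\<Sum>i<N. (coef \<phi> i)\<^sup>2 * lam i powr s) \<le> H_inner \<phi> \<phi>"
    using Hs0_inner_self_sums[OF assms] sum_le_suminf[of "\<lambda>i. (coef \<phi> i)\<^sup>2 * lam i powr s" "{..<N}"]
    by (simp add: sums_iff)
  then show ?thesis
    by (simp add: H.nrm_def Hs0_inner_proj assms)
qed

lemma proj_tendsto:
  assumes "\<phi> \<in> H"
  shows "(\<lambda>N. H.nrm (\<lambda>x. proj N \<phi> x - \<phi> x)) \<longlonglongrightarrow> 0"
proof -
  have "(\<lambda>N. H_inner \<phi> \<phi> - (\<Sum>i<N. (coef \<phi> i)\<^sup>2 * lam i powr s)) \<longlonglongrightarrow> H_inner \<phi> \<phi> - H_inner \<phi> \<phi>"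
    using Hs0_inner_self_sums[OF assms] by (intro tendsto_intros) (simp add: sums_def)
  moreover have "H_inner (\<lambda>x. proj N \<phi> x - \<phi> x) (\<lambda>x. proj N \<phi> x - \<phi> x)
      = H_inner \<phi> \<phi> - (\<Sum>i<N. (coef \<phi> i)\<^sup>2 * lam i powr s)" for N
    using assms by (simp add: H.diff_left H.diff_right H.diff_mem proj_Hs0 Hs0_inner_proj
        H.sym[of \<phi> "proj N \<phi>"])
  ultimately have "(\<lambda>N. H_inner (\<lambda>x. proj N \<phi> x - \<phi> x) (\<lambda>x. proj N \<phi> x - \<phi> x)) \<longlonglongrightarrow> 0"
    by simp
  from tendsto_real_sqrt[OF this] show ?thesis
    by (simp add: H.nrm_def)
qed

end


section \<open>Hoelder's inequality for the nonlinearity\<close>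

lemma Lp_norm_nonneg: "0 \<le> Lp_norm p \<Omega> f"
  by (simp add: Lp_norm_def)

lemma Lp_norm_powr:
  assumes "p > 0"
  shows "Lp_norm p \<Omega> f powr p = (LINT x|lebesgue_on \<Omega>. \<bar>f x\<bar> powr p)"
  using assms by (simp add: Lp_norm_def powr_powr)

lemma Lp_norm_eq_0_imp_AE:
  assumes "p > 0" "f \<in> Lp_space p \<Omega>" "Lp_norm p \<Omega> f = 0"
  shows "AE x in lebesgue_on \<Omega>. f x = 0"
proof -
  have "(LINT x|lebesgue_on \<Omega>. \<bar>f x\<bar> powr p) = 0"
    using Lp_norm_powr[OF assms(1), of \<Omega> f] assms by simp
  then have "AE x in lebesgue_on \<Omega>. \<bar>f x\<bar> powr p = 0"
    using assms(2) by (subst (asm) integral_nonneg_eq_0_iff_AE) (auto simp: Lp_space_def)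
  then show ?thesis by eventually_elim simp
qed

text \<open>Hoelder's inequality with exponents \<open>p/(p-1)\<close> and \<open>p\<close>,
  obtained by integrating Young's inequality for \<open>f\<close> and \<open>g\<close> divided by
  their norms. A vanishing norm is treated apart, since then one factor is 0 almost
  everywhere.\<close>

lemma integral_power_nonlinearity_le:
  assumes p: "p > 1" and f: "f \<in> Lp_space p \<Omega>" and g: "g \<in> Lp_space p \<Omega>"
  shows "L2_inner \<Omega> (\<lambda>x. \<bar>f x\<bar> powr (p - 2) * f x) g \<le> Lp_norm p \<Omega> f powr (p - 1) * Lp_norm p \<Omega> g"
proof (cases "Lp_norm p \<Omega> f = 0 \<or> Lp_norm p \<Omega> g = 0")
  case True
  have "AE x in lebesgue_on \<Omega>. \<bar>f x\<bar> powr (p - 2) * f x * g x = 0"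
  proof (cases "Lp_norm p \<Omega> f = 0")
    case True
    then have "AE x in lebesgue_on \<Omega>. f x = 0"
      using p f by (intro Lp_norm_eq_0_imp_AE[of p]) auto
    then show ?thesis by eventually_elim simp
  next
    case False
    then have "AE x in lebesgue_on \<Omega>. g x = 0"
      using True p g by (intro Lp_norm_eq_0_imp_AE[of p]) auto
    then show ?thesis by eventually_elim simp
  qed
  then have "L2_inner \<Omega> (\<lambda>x. \<bar>f x\<bar> powr (p - 2) * f x) g = 0"
    unfolding L2_inner_def by (rule integral_eq_zero_AE)
  then show ?thesis by (simp add: Lp_norm_nonneg)
next
  case False
  define a b where "a = Lp_norm p \<Omega> f" and "b = Lp_norm p \<Omega> g"
  have ab: "a > 0" "b > 0"
    using False Lp_norm_nonneg[of p \<Omega> f] Lp_norm_nonneg[of p \<Omega> g] by (auto simp: a_def b_def)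
  have a_p: "a powr p = (LINT x|lebesgue_on \<Omega>. \<bar>f x\<bar> powr p)"
    and b_p: "b powr p = (LINT x|lebesgue_on \<Omega>. \<bar>g x\<bar> powr p)"
    using p by (simp_all add: a_def b_def Lp_norm_powr)
  \<comment> \<open>Young's bound multiplied back by the norms; its bracket integrates to
    \<open>(p - 1) / p + 1 / p = 1\<close>.\<close>
  let ?R = "\<lambda>x. a powr (p - 1) * b *
    (\<bar>f x\<bar> powr p / a powr p * ((p - 1) / p) + \<bar>g x\<bar> powr p / b powr p / p)"
  have int: "integrable (lebesgue_on \<Omega>) ?R"
    using f g by (simp add: Lp_space_def)
  have le: "\<bar>f x\<bar> powr (p - 2) * f x * g x \<le> ?R x" for x
  proof -
    have "\<bar>f x\<bar> powr (p - 2) * f x * g x \<le> \<bar>\<bar>f x\<bar> powr (p - 2) * f x * g x\<bar>"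
      by simp
    also have "\<dots> = \<bar>f x\<bar> powr (p - 1) * \<bar>g x\<bar>"
    proof (cases "f x = 0")
      case False
      then have "\<bar>f x\<bar> powr (p - 1) = \<bar>f x\<bar> powr (p - 2) * \<bar>f x\<bar>"
        using powr_add[of "\<bar>f x\<bar>" "p - 2" 1] by simp
      then show ?thesis by (simp add: abs_mult)
    qed simp
    also have "\<dots> = a powr (p - 1) * b * ((\<bar>f x\<bar> / a) powr (p - 1) * (\<bar>g x\<bar> / b))"
      using ab by (simp add: powr_divide)
    also have "\<dots> \<le> a powr (p - 1) * b *
        (((\<bar>f x\<bar> / a) powr (p - 1)) powr (p / (p - 1)) / (p / (p - 1)) + (\<bar>g x\<bar> / b) powr p / p)"
      using p ab by (intro mult_left_mono Youngs_inequality) (auto simp: field_simps)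
    also have "\<dots> = ?R x"
      using p ab by (simp add: powr_powr powr_divide)
    finally show ?thesis .
  qed
  \<comment> \<open>Needed because the integral on the left would take the default value 0 if its
    integrand were not integrable.\<close>
  have nonneg: "0 \<le> ?R x" for x
    using p ab by (intro mult_nonneg_nonneg add_nonneg_nonneg) auto
  have "L2_inner \<Omega> (\<lambda>x. \<bar>f x\<bar> powr (p - 2) * f x) g \<le> (LINT x|lebesgue_on \<Omega>. ?R x)"
    unfolding L2_inner_def by (rule integral_mono'[OF int le nonneg])
  also have "\<dots> = a powr (p - 1) * b * (a powr p / a powr p * ((p - 1) / p) + b powr p / b powr p / p)"
    unfolding a_p b_p using f g by (simp add: Lp_space_def)
  also have "\<dots> = a powr (p - 1) * b"
    using p ab by (simp add: add_divide_distrib[symmetric])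
  finally show ?thesis by (simp add: a_def b_def)
qed


section \<open>The energy form\<close>

text \<open>The constant \<open>K\<close> makes the energy norm equivalent to the norm of
  \<open>H\<close>, so that limits in \<open>H\<close> pass to the energy form.\<close>

locale hardy_system = dirichlet_system \<Omega> e lam s
  for \<Omega> :: "'a::euclidean_space set" and e lam s +
  fixes K :: real
  assumes hardy_const: "K > 0" and hardy: "hardy_inequality \<Omega> e lam s K"
begin

text \<open>Keeping the weight as a separate factor fits \<open>integrable_mult_weight\<close>. At
  the origin \<open>0 powr (2 * s) = 0\<close> and division by 0 give it the value 0.\<close>

definition hardy_inner :: "('a \<Rightarrow> real) \<Rightarrow> ('a \<Rightarrow> real) \<Rightarrow> real" where
  "hardy_inner \<phi> \<psi> = (LINT x|lebesgue_on \<Omega>. 1 / norm x powr (2 * s) * (\<phi> x * \<psi> x))"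

definition energy_inner :: "('a \<Rightarrow> real) \<Rightarrow> ('a \<Rightarrow> real) \<Rightarrow> real" where
  "energy_inner \<phi> \<psi> = hardy_inner \<phi> \<psi> + H_inner \<phi> \<psi>"

lemma hardy_integrable:
  assumes "\<phi> \<in> H" "\<psi> \<in> H"
  shows "integrable (lebesgue_on \<Omega>) (\<lambda>x. 1 / norm x powr (2 * s) * (\<phi> x * \<psi> x))"
proof (rule integrable_mult_weight)
  have "(\<lambda>x::'a. 1 / norm x powr (2 * s)) \<in> borel_measurable borel"
    by measurable
  then show "(\<lambda>x. 1 / norm x powr (2 * s)) \<in> borel_measurable (lebesgue_on \<Omega>)"
    by (intro measurable_restrict_space1 measurable_completion) simp
qed (use assms hardy in \<open>auto simp: hardy_inequality_def Lp_space_2_iff dest!: Hs0_L2\<close>)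

lemma hardy_inner_le:
  assumes "\<phi> \<in> H"
  shows "0 \<le> hardy_inner \<phi> \<phi>" "hardy_inner \<phi> \<phi> \<le> K * H_inner \<phi> \<phi>"
proof -
  show "0 \<le> hardy_inner \<phi> \<phi>"
    by (simp add: hardy_inner_def integral_nonneg_AE)
  show "hardy_inner \<phi> \<phi> \<le> K * H_inner \<phi> \<phi>"
    using hardy[unfolded hardy_inequality_def, rule_format, OF assms] H.nrm_square[OF assms]
    by (simp add: hardy_inner_def nrm_Hs0 flip: power2_eq_square)
qed

sublocale E: semi_inner H energy_inner
proof
  fix f g assume fg: "f \<in> H" "g \<in> H"
  show "energy_inner f g = energy_inner g f"
    using H.sym[OF fg] by (simp add: energy_inner_def hardy_inner_def mult.commute)
next
  fix f g h assume *: "f \<in> H" "g \<in> H" "h \<in> H"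
  have "hardy_inner (\<lambda>x. f x + g x) h = hardy_inner f h + hardy_inner g h"
    using hardy_integrable[OF *(1,3)] hardy_integrable[OF *(2,3)]
    unfolding hardy_inner_def by (simp add: distrib_right distrib_left flip: Bochner_Integration.integral_add)
  then show "energy_inner (\<lambda>x. f x + g x) h = energy_inner f h + energy_inner g h"
    using * by (simp add: energy_inner_def H.add_left)
next
  fix f h c assume *: "f \<in> H" "h \<in> H"
  have "hardy_inner (\<lambda>x. c * f x) h = c * hardy_inner f h"
    unfolding hardy_inner_def integral_mult_right_zero[symmetric]
    by (intro Bochner_Integration.integral_cong) auto
  then show "energy_inner (\<lambda>x. c * f x) h = c * energy_inner f h"
    using * by (simp add: energy_inner_def H.scale_left distrib_left)
next
  fix f assume "f \<in> H"
  then show "0 \<le> energy_inner f f"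
    by (simp add: energy_inner_def hardy_inner_le H.nonneg)
qed (auto intro: H.zero_mem H.add_mem H.scale_mem)

lemma energy_eq:
  assumes "\<phi> \<in> H"
  shows "energy \<Omega> e lam s \<phi> = energy_inner \<phi> \<phi>"
  using H.nrm_square[OF assms]
  by (simp add: energy_def energy_inner_def hardy_inner_def nrm_Hs0 Hs0_norm_def power2_eq_square)

text \<open>The embedding inequality yields powers of the norm of \<open>H\<close>; this comparison
  replaces them by powers of the energy without a further constant.\<close>

lemma norm_le_energy: "\<phi> \<in> H \<Longrightarrow> H.nrm \<phi> \<le> E.nrm \<phi>"
  by (simp add: H.nrm_def E.nrm_def energy_inner_def hardy_inner_le)

lemma energy_norm_le:
  assumes "\<phi> \<in> H"
  shows "E.nrm \<phi> \<le> sqrt (1 + K) * H.nrm \<phi>"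
proof -
  have "energy_inner \<phi> \<phi> \<le> (1 + K) * H_inner \<phi> \<phi>"
    using hardy_inner_le[OF assms] by (simp add: energy_inner_def distrib_right)
  then show ?thesis
    by (simp add: H.nrm_def E.nrm_def flip: real_sqrt_mult)
qed

lemma energy_tendsto_0:
  assumes "\<forall>\<^sub>F n in F. f n \<in> H" "((\<lambda>n. H.nrm (f n)) \<longlongrightarrow> 0) F"
  shows "((\<lambda>n. E.nrm (f n)) \<longlongrightarrow> 0) F"
proof (rule Lim_null_comparison)
  show "\<forall>\<^sub>F n in F. norm (E.nrm (f n)) \<le> sqrt (1 + K) * H.nrm (f n)"
    using assms(1) by eventually_elim (simp add: energy_norm_le E.nrm_nonneg)
  show "((\<lambda>n. sqrt (1 + K) * H.nrm (f n)) \<longlongrightarrow> 0) F"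
    using tendsto_mult_right_zero[OF assms(2)] .
qed

text \<open>\<open>frac_lap\<close> sees its argument only through coefficients, so for functions
  equal almost everywhere \<open>SOME\<close> returns the very same function. This exchanges
  \<open>u 0\<close> for the initial datum \<open>u0\<close>.\<close>

lemma energy_cong_AE:
  assumes "\<phi> \<in> Lp_space 2 \<Omega>" "\<psi> \<in> Lp_space 2 \<Omega>" "AE x in lebesgue_on \<Omega>. \<phi> x = \<psi> x"
  shows "energy \<Omega> e lam s \<phi> = energy \<Omega> e lam s \<psi>"
proof -
  have [measurable]: "\<phi> \<in> borel_measurable (lebesgue_on \<Omega>)" "\<psi> \<in> borel_measurable (lebesgue_on \<Omega>)"
      "e i \<in> borel_measurable (lebesgue_on \<Omega>)" for i
    using assms eigenfunction_L2 by (auto simp: Lp_space_2_iff)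
  have "(\<lambda>x::'a. norm x powr (2 * s)) \<in> borel_measurable borel"
    by measurable
  then have [measurable]: "(\<lambda>x. norm x powr (2 * s)) \<in> borel_measurable (lebesgue_on \<Omega>)"
    by (intro measurable_restrict_space1 measurable_completion) simp
  have "coef \<phi> i = coef \<psi> i" for i
    unfolding L2_inner_def using assms(3) by (intro integral_cong_AE) auto
  then have "frac_lap \<Omega> e lam (s / 2) \<phi> = frac_lap \<Omega> e lam (s / 2) \<psi>"
    by (simp add: frac_lap_def)
  moreover have "(LINT x|lebesgue_on \<Omega>. (\<phi> x)\<^sup>2 / norm x powr (2 * s))
      = (LINT x|lebesgue_on \<Omega>. (\<psi> x)\<^sup>2 / norm x powr (2 * s))"
    using assms(3) by (intro integral_cong_AE) auto
  ultimately show ?thesis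
    by (simp add: energy_def)
qed

text \<open>If \<open>\<lambda>\<^sub>i\<^sup>s = 0\<close>, the form vanishes at \<open>e\<^sub>i\<close> and the quotient is \<open>0 / 0 = 0\<close>.\<close>

lemma energy_inner_proj:
  assumes "\<phi> \<in> H" "\<nu> \<in> H"
  shows "energy_inner (proj N \<phi>) \<nu> = (\<Sum>i<N. H_inner \<phi> (e i) * (energy_inner (e i) \<nu> / lam i powr s))"
proof -
  have "coef \<phi> i * energy_inner (e i) \<nu> = H_inner \<phi> (e i) * (energy_inner (e i) \<nu> / lam i powr s)" for i
  proof (cases "lam i powr s = 0")
    case True
    have "H.nrm (e i) = 0"
      using Hs0_inner_eigenfunction[OF eigenfunction_Hs0, of i i] True by (simp add: H.nrm_def)
    then have "E.nrm (e i) = 0"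
      using energy_norm_le[OF eigenfunction_Hs0, of i] E.nrm_nonneg[OF eigenfunction_Hs0, of i] by simp
    then have "energy_inner (e i) \<nu> = 0"
      using E.Cauchy_Schwarz[OF eigenfunction_Hs0 assms(2), of i] by simp
    then show ?thesis by simp
  qed (simp add: Hs0_inner_eigenfunction assms)
  then show ?thesis
    unfolding proj_def[abs_def] by (simp add: E.sum_left eigenfunction_Hs0 assms)
qed

end

text \<open>The embedding is applied to both Hoelder factors, giving \<open>C powr (p - 1)\<close>
  times \<open>C\<close>.\<close>

lemma (in dirichlet_system) nonlinearity_le:
  assumes p: "p > 1" and emb: "embedding_inequality \<Omega> e lam s p C" and "C > 0"
    and "\<phi> \<in> H" "\<nu> \<in> H"
  shows "L2_inner \<Omega> (\<lambda>x. \<bar>\<phi> x\<bar> powr (p - 2) * \<phi> x) \<nu> \<le> C powr p * H.nrm \<phi> powr (p - 1) * H.nrm \<nu>"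
proof -
  have Lp: "f \<in> Lp_space p \<Omega>" "Lp_norm p \<Omega> f \<le> C * H.nrm f" if "f \<in> H" for f
    using emb that by (auto simp: embedding_inequality_def nrm_Hs0)
  have "L2_inner \<Omega> (\<lambda>x. \<bar>\<phi> x\<bar> powr (p - 2) * \<phi> x) \<nu> \<le> Lp_norm p \<Omega> \<phi> powr (p - 1) * Lp_norm p \<Omega> \<nu>"
    using assms Lp by (intro integral_power_nonlinearity_le) auto
  also have "\<dots> \<le> (C * H.nrm \<phi>) powr (p - 1) * (C * H.nrm \<nu>)"
    using assms Lp by (intro mult_mono powr_mono2) (auto simp: Lp_norm_nonneg)
  also have "\<dots> = C powr p * H.nrm \<phi> powr (p - 1) * H.nrm \<nu>"
    using \<open>C > 0\<close> H.nrm_nonneg[OF \<open>\<phi> \<in> H\<close>] powr_add[of C "p - 1" 1] by (simp add: powr_mult)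
  finally show ?thesis .
qed


section \<open>The energy along a weak solution\<close>

lemma AE_lebesgue_on_subset:
  assumes "AE x in lebesgue_on B. P x" "A \<subseteq> B" "A \<in> sets lebesgue" "B \<in> sets lebesgue"
  shows "AE x in lebesgue_on A. P x"
proof -
  have "AE x in lebesgue. x \<in> B \<longrightarrow> P x"
    using assms by (simp add: AE_restrict_space_iff)
  then have "AE x in lebesgue. x \<in> A \<longrightarrow> P x"
    by eventually_elim (use assms(2) in auto)
  then show ?thesis
    using assms by (simp add: AE_restrict_space_iff)
qed

lemma integrable_lebesgue_on_subset:
  fixes f :: "'b::euclidean_space \<Rightarrow> real"
  assumes "integrable (lebesgue_on B) f" "A \<subseteq> B" "A \<in> sets lebesgue" "B \<in> sets lebesgue"
  shows "integrable (lebesgue_on A) f"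
proof -
  have "set_integrable lebesgue B f"
    using assms by (simp add: set_integrable_def integrable_restrict_space)
  then have "set_integrable lebesgue A f"
    by (rule set_integrable_subset) (use assms in auto)
  then show ?thesis
    using assms by (simp add: set_integrable_def integrable_restrict_space)
qed

text \<open>The pointwise \<open>lim\<close> is measurable and agrees with \<open>g\<close> off a
  null set; completeness of Lebesgue measure transfers measurability to \<open>g\<close>.\<close>

lemma borel_measurable_lebesgue_on_AE_limit:
  fixes f :: "nat \<Rightarrow> 'b::euclidean_space \<Rightarrow> real"
  assumes X: "X \<in> sets lebesgue" and f: "\<And>k. f k \<in> borel_measurable (lebesgue_on X)"
    and lim: "AE t in lebesgue_on X. (\<lambda>k. f k t) \<longlonglongrightarrow> g t"
  shows "g \<in> borel_measurable (lebesgue_on X)"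
proof -
  define h where "h t = lim (\<lambda>k. f k t)" for t
  have "h \<in> borel_measurable (lebesgue_on X)"
    unfolding h_def using f by measurable
  then have "(\<lambda>t. indicator X t *\<^sub>R h t) \<in> borel_measurable lebesgue"
    using X by (subst (asm) borel_measurable_restrict_space_iff) auto
  moreover have "AE t in lebesgue. t \<in> X \<longrightarrow> (\<lambda>k. f k t) \<longlonglongrightarrow> g t"
    using lim X by (simp add: AE_restrict_space_iff)
  then have "AE t in lebesgue. indicator X t *\<^sub>R h t = indicator X t *\<^sub>R g t"
    by eventually_elim (auto simp: h_def indicator_def limI)
  ultimately have "(\<lambda>t. indicator X t *\<^sub>R g t) \<in> borel_measurable lebesgue"
    by (rule borel_measurable_AE)
  then show ?thesis
    using X by (subst borel_measurable_restrict_space_iff) auto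
qed

text \<open>The value type carries no sigma-algebra, so \<open>F\<close> is arbitrary: the composite
  is a finite combination of indicators of level sets.\<close>

lemma borel_measurable_finitely_many_values:
  fixes S :: "'b::euclidean_space \<Rightarrow> 'c" and F :: "'c \<Rightarrow> real"
  assumes X: "X \<in> sets lebesgue" and fin: "finite (S ` X)"
    and S: "\<And>\<phi>. {t \<in> X. S t = \<phi>} \<in> sets lebesgue"
  shows "(\<lambda>t. F (S t)) \<in> borel_measurable (lebesgue_on X)"
proof -
  have "(\<lambda>t. \<Sum>\<phi>\<in>S ` X. F \<phi> * indicator {t \<in> X. S t = \<phi>} t) \<in> borel_measurable (lebesgue_on X)"
    using S X by (intro borel_measurable_sum borel_measurable_times borel_measurable_const
        borel_measurable_indicator) (auto simp: sets_restrict_space_iff)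
  moreover have "(\<Sum>\<phi>\<in>S ` X. F \<phi> * indicator {t \<in> X. S t = \<phi>} t) = F (S t)" if "t \<in> X" for t
  proof -
    have "(\<Sum>\<phi>\<in>S ` X. F \<phi> * indicator {t \<in> X. S t = \<phi>} t) = (\<Sum>\<phi>\<in>S ` X. if \<phi> = S t then F \<phi> else 0)"
      using that by (intro sum.cong) (auto simp: indicator_def)
    also have "\<dots> = F (S t)"
      using fin that by (simp add: sum.delta)
    finally show ?thesis .
  qed
  ultimately show ?thesis
    by (subst (asm) measurable_lebesgue_cong) auto
qed

context hardy_system
begin

lemma strongly_measurable_inner:
  assumes "Hs0_strongly_measurable \<Omega> e lam s T w" "\<nu> \<in> H"
  shows "(\<lambda>t. H_inner (w t) \<nu>) \<in> borel_measurable (lebesgue_on {0<..<T})"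
proof -
  obtain S :: "nat \<Rightarrow> real \<Rightarrow> 'a \<Rightarrow> real" where
    S: "\<And>k. finite (S k ` {0<..<T})" "\<And>k. S k ` {0<..<T} \<subseteq> H"
      "\<And>k \<phi>. {t\<in>{0<..<T}. S k t = \<phi>} \<in> sets lebesgue"
    and lim: "AE t in lebesgue_on {0<..<T}. (\<lambda>k. H_norm (\<lambda>x. S k t x - w t x)) \<longlonglongrightarrow> 0"
    and w: "AE t in lebesgue_on {0<..<T}. w t \<in> H"
    using assms(1) unfolding Hs0_strongly_measurable_def by blast
  have "AE t in lebesgue_on {0<..<T}. t \<in> {0<..<T}"
    by (rule AE_I2) simp
  then have "AE t in lebesgue_on {0<..<T}. (\<lambda>k. H_inner (S k t) \<nu>) \<longlonglongrightarrow> H_inner (w t) \<nu>"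
    using lim w
  proof eventually_elim
    case (elim t)
    have "S k t \<in> H" for k
      using S(2)[of k] elim(1) by blast
    then show ?case
      using elim by (intro H.tendsto_left assms) (simp_all add: nrm_Hs0)
  qed
  then show ?thesis
    by (rule borel_measurable_lebesgue_on_AE_limit[rotated 2])
       (auto intro!: borel_measurable_finitely_many_values[where F = "\<lambda>\<phi>. H_inner \<phi> \<nu>"] S(1,3))
qed

lemma Hs0_continuous_mem: "Hs0_continuous \<Omega> e lam s T u \<Longrightarrow> t \<in> {0..<T} \<Longrightarrow> u t \<in> H"
  by (simp add: Hs0_continuous_def)

lemma Hs0_continuous_tendsto:
  "Hs0_continuous \<Omega> e lam s T u \<Longrightarrow> t \<in> {0..<T} \<Longrightarrow>
    ((\<lambda>r. H.nrm (\<lambda>x. u r x - u t x)) \<longlongrightarrow> 0) (at t within {0..<T})"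
  by (simp add: Hs0_continuous_def nrm_Hs0)

lemma eventually_at_within_mem: "\<forall>\<^sub>F r in at t within A. r \<in> A"
  by (simp add: eventually_at_filter)

lemma Hs0_continuous_inner:
  assumes u: "Hs0_continuous \<Omega> e lam s T u" and "\<nu> \<in> H"
  shows "continuous_on {0..<T} (\<lambda>t. H_inner (u t) \<nu>)"
  unfolding continuous_on_def
proof
  fix t assume t: "t \<in> {0..<T}"
  show "((\<lambda>t. H_inner (u t) \<nu>) \<longlongrightarrow> H_inner (u t) \<nu>) (at t within {0..<T})"
    by (intro H.tendsto_left Hs0_continuous_tendsto[OF u t] Hs0_continuous_mem[OF u t] assms
        eventually_mono[OF eventually_at_within_mem] Hs0_continuous_mem[OF u])
qed

text \<open>The scalar result on weak derivatives gives the increments of the pairings with each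
  \<open>e i\<close>. Finite combinations of these are the energy pairings of \<open>proj N\<close>,
  and dominated convergence removes the projection.\<close>

lemma energy_inner_increment:
  assumes ut: "ut \<in> L2_Hs0 \<Omega> e lam s T" and u: "Hs0_continuous \<Omega> e lam s T u"
    and weak: "weak_time_derivative \<Omega> e lam s T u ut"
    and ab: "0 \<le> a" "a < b" "b < T" and \<nu>: "\<nu> \<in> H"
  shows "integrable (lebesgue_on {a<..<b}) (\<lambda>t. energy_inner (ut t) \<nu>)"
    and "energy_inner (u b) \<nu> - energy_inner (u a) \<nu> = (LINT t|lebesgue_on {a<..<b}. energy_inner (ut t) \<nu>)"
proof -
  interpret T: finite_measure "lebesgue_on {0<..<T}"
    by (rule finite_measure_lebesgue_on) auto
  have sub: "{a<..<b} \<subseteq> {0<..<T}" "{a<..<b} \<in> sets lebesgue" "{0<..<T} \<in> sets lebesgue"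
    using ab by auto
  have ut_meas: "Hs0_strongly_measurable \<Omega> e lam s T ut"
    and ut_sq: "integrable (lebesgue_on {0<..<T}) (\<lambda>t. (H.nrm (ut t))\<^sup>2)"
    using ut by (auto simp: L2_Hs0_def nrm_Hs0)
  have ut_H: "AE t in lebesgue_on {0<..<T}. ut t \<in> H"
    using ut_meas by (simp add: Hs0_strongly_measurable_def)
  have ut_nrm: "integrable (lebesgue_on {0<..<T}) (\<lambda>t. c * (1 + (H.nrm (ut t))\<^sup>2))" for c
    using ut_sq by simp
  \<comment> \<open>Turns square integrability of the norm into a dominating function that is
    integrable on a bounded interval.\<close>
  have le_sq: "r \<le> 1 + r\<^sup>2" for r :: real
    using zero_le_power2[of "r - 1 / 2"] by (simp add: power2_eq_square algebra_simps)
  have inner_int: "integrable (lebesgue_on {0<..<T}) (\<lambda>t. H_inner (ut t) \<psi>)" if "\<psi> \<in> H" for \<psi>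
  proof (rule Bochner_Integration.integrable_bound[OF ut_nrm[of "H.nrm \<psi>"]])
    show "(\<lambda>t. H_inner (ut t) \<psi>) \<in> borel_measurable (lebesgue_on {0<..<T})"
      by (rule strongly_measurable_inner[OF ut_meas that])
    show "AE t in lebesgue_on {0<..<T}. norm (H_inner (ut t) \<psi>) \<le> norm (H.nrm \<psi> * (1 + (H.nrm (ut t))\<^sup>2))"
      using ut_H
    proof eventually_elim
      case (elim t)
      have "\<bar>H_inner (ut t) \<psi>\<bar> \<le> H.nrm (ut t) * H.nrm \<psi>"
        by (rule H.Cauchy_Schwarz[OF elim that])
      also have "\<dots> \<le> (1 + (H.nrm (ut t))\<^sup>2) * H.nrm \<psi>"
        by (intro mult_right_mono le_sq H.nrm_nonneg that)
      finally show ?case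
        using H.nrm_nonneg[OF that] by (simp add: abs_mult mult.commute)
    qed
  qed
  have increment: "H_inner (u b) \<psi> - H_inner (u a) \<psi> = (LINT t|lebesgue_on {a<..<b}. H_inner (ut t) \<psi>)"
    if "\<psi> \<in> H" for \<psi>
    using weak that
    by (intro weak_derivative_imp_integral[OF Hs0_continuous_inner[OF u that] inner_int[OF that]] ab)
       (auto simp: weak_time_derivative_def)
  have ut_H': "AE t in lebesgue_on {a<..<b}. ut t \<in> H"
    by (rule AE_lebesgue_on_subset[OF ut_H sub])
  have int': "integrable (lebesgue_on {a<..<b}) (\<lambda>t. H_inner (ut t) (e i) * c)" for i c
    using integrable_lebesgue_on_subset[OF inner_int[OF eigenfunction_Hs0] sub] by simp
  define w where "w i = energy_inner (e i) \<nu> / lam i powr s" for i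
  \<comment> \<open>Written through \<open>H_inner \<phi> (e i)\<close>, the only data the weak
    derivative controls. As a formula it is measurable along \<open>ut\<close> at all times, while
    its reading as an energy pairing requires \<open>\<phi> \<in> H\<close>, which \<open>ut\<close>
    satisfies only almost everywhere.\<close>
  define P where "P N \<phi> = (\<Sum>i<N. H_inner \<phi> (e i) * w i)" for N \<phi>
  have P_eq: "P N \<phi> = energy_inner (proj N \<phi>) \<nu>" if "\<phi> \<in> H" for N \<phi>
    using that \<nu> by (simp add: P_def w_def energy_inner_proj)
  have P_lim: "(\<lambda>N. P N \<phi>) \<longlonglongrightarrow> energy_inner \<phi> \<nu>" if "\<phi> \<in> H" for \<phi>
    unfolding P_eq[OF that] using that \<nu>
    by (intro E.tendsto_left energy_tendsto_0 proj_tendsto)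
       (simp_all add: proj_Hs0 H.diff_mem)
  have P_le: "\<bar>P N \<phi>\<bar> \<le> sqrt (1 + K) * E.nrm \<nu> * (1 + (H.nrm \<phi>)\<^sup>2)" if "\<phi> \<in> H" for N \<phi>
  proof -
    have "\<bar>P N \<phi>\<bar> \<le> E.nrm (proj N \<phi>) * E.nrm \<nu>"
      unfolding P_eq[OF that] by (rule E.Cauchy_Schwarz[OF proj_Hs0 \<nu>])
    also have "\<dots> \<le> (sqrt (1 + K) * (1 + (H.nrm \<phi>)\<^sup>2)) * E.nrm \<nu>"
    proof (rule mult_right_mono[OF _ E.nrm_nonneg[OF \<nu>]])
      have "E.nrm (proj N \<phi>) \<le> sqrt (1 + K) * H.nrm (proj N \<phi>)"
        by (rule energy_norm_le[OF proj_Hs0])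
      also have "\<dots> \<le> sqrt (1 + K) * (1 + (H.nrm \<phi>)\<^sup>2)"
        using hardy_const by (intro mult_left_mono order_trans[OF proj_norm_le[OF that] le_sq]) simp
      finally show "E.nrm (proj N \<phi>) \<le> sqrt (1 + K) * (1 + (H.nrm \<phi>)\<^sup>2)" .
    qed
    finally show ?thesis by (simp add: mult_ac)
  qed
  have P_meas: "(\<lambda>t. P N (ut t)) \<in> borel_measurable (lebesgue_on {a<..<b})" for N
    unfolding P_def by (intro borel_measurable_sum borel_measurable_integrable[OF int'])
  have P_ut_lim: "AE t in lebesgue_on {a<..<b}. (\<lambda>N. P N (ut t)) \<longlonglongrightarrow> energy_inner (ut t) \<nu>"
    using ut_H' by eventually_elim (rule P_lim)
  have P_ut_le: "AE t in lebesgue_on {a<..<b}.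
      norm (P N (ut t)) \<le> sqrt (1 + K) * E.nrm \<nu> * (1 + (H.nrm (ut t))\<^sup>2)" for N
    using ut_H' by eventually_elim (simp add: P_le)
  have E_meas: "(\<lambda>t. energy_inner (ut t) \<nu>) \<in> borel_measurable (lebesgue_on {a<..<b})"
    by (rule borel_measurable_lebesgue_on_AE_limit[OF sub(2) P_meas P_ut_lim])
  have dom: "integrable (lebesgue_on {a<..<b}) (\<lambda>t. sqrt (1 + K) * E.nrm \<nu> * (1 + (H.nrm (ut t))\<^sup>2))"
    by (rule integrable_lebesgue_on_subset[OF ut_nrm sub])
  show "integrable (lebesgue_on {a<..<b}) (\<lambda>t. energy_inner (ut t) \<nu>)"
    by (rule integrable_dominated_convergence[OF E_meas P_meas dom P_ut_lim P_ut_le])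
  have "(\<lambda>N. LINT t|lebesgue_on {a<..<b}. P N (ut t)) \<longlonglongrightarrow> (LINT t|lebesgue_on {a<..<b}. energy_inner (ut t) \<nu>)"
    by (rule integral_dominated_convergence[OF E_meas P_meas dom P_ut_lim P_ut_le])
  moreover have "(LINT t|lebesgue_on {a<..<b}. P N (ut t)) = P N (u b) - P N (u a)" for N
    unfolding P_def using int'
    by (simp add: Bochner_Integration.integral_sum increment[symmetric] eigenfunction_Hs0
        sum_subtractf left_diff_distrib)
  moreover have "(\<lambda>N. P N (u b) - P N (u a)) \<longlonglongrightarrow> energy_inner (u b) \<nu> - energy_inner (u a) \<nu>"
    using ab by (intro tendsto_diff P_lim Hs0_continuous_mem[OF u]) auto
  ultimately show "energy_inner (u b) \<nu> - energy_inner (u a) \<nu>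
      = (LINT t|lebesgue_on {a<..<b}. energy_inner (ut t) \<nu>)"
    using LIMSEQ_unique by fastforce
qed

end


section \<open>Growth and continuity of the energy in time\<close>

context hardy_system
begin

text \<open>Everything is frozen at time \<open>a\<close>, with \<open>\<eta>\<close> bounding the
  drift of \<open>u\<close>. As \<open>\<eta>\<close> tends to 0 the bracket tends to
  \<open>2 * C powr p * n powr p - 2 * n\<^sup>2\<close>.\<close>

lemma energy_increment_le:
  assumes sol: "weak_solution \<Omega> e lam s p u0 T u"
    and p: "p > 1" and emb: "embedding_inequality \<Omega> e lam s p C" "C > 0"
    and ab: "0 \<le> a" "a < b" "b < T"
    and close: "\<And>t. t \<in> {a..b} \<Longrightarrow> H.nrm (\<lambda>x. u t x - u a x) \<le> \<eta>"
  defines "n \<equiv> H.nrm (u a)"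
  shows "energy \<Omega> e lam s (u b) - energy \<Omega> e lam s (u a)
    \<le> (b - a) * (C powr p * (n + \<eta>) powr (p - 1) * (2 * n + \<eta>) - 2 * n\<^sup>2 + n * \<eta> + \<eta> * (2 * n + \<eta>))"
    (is "_ \<le> _ * ?R")
proof -
  have u: "Hs0_continuous \<Omega> e lam s T u"
    using sol by (simp add: weak_solution_def)
  obtain ut where ut: "ut \<in> L2_Hs0 \<Omega> e lam s T" "weak_time_derivative \<Omega> e lam s T u ut"
    and eq: "\<And>\<nu>. \<nu> \<in> H \<Longrightarrow> AE t in lebesgue_on {0<..<T}.
        L2_inner \<Omega> (\<lambda>x. norm x powr (- 2 * s) * ut t x) \<nu> + H_inner (u t) \<nu> + H_inner (ut t) \<nu>
        = L2_inner \<Omega> (\<lambda>x. \<bar>u t x\<bar> powr (p - 2) * u t x) \<nu>"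
    using sol unfolding weak_solution_def Hs0_inner_def by blast
  have mem: "u t \<in> H" if "t \<in> {a..b}" for t
    using Hs0_continuous_mem[OF u] that ab by simp
  have ua: "u a \<in> H" and ubH: "u b \<in> H"
    using mem ab by auto
  define \<nu> where "\<nu> = (\<lambda>x. u a x + u b x)"
  have \<nu>: "\<nu> \<in> H"
    unfolding \<nu>_def by (intro H.add_mem ua ubH)
  have nrm_u: "H.nrm (u t) \<le> n + \<eta>" if "t \<in> {a..b}" for t
    using H.nrm_diff_abs_le[OF mem[OF that] ua] close[OF that] by (simp add: n_def)
  have n0: "n \<ge> 0"
    unfolding n_def by (rule H.nrm_nonneg[OF ua])
  have \<eta>0: "\<eta> \<ge> 0"
    using close[of a] ab H.nrm_nonneg[OF H.diff_mem[OF ua ua]] by auto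
  have nrm_\<nu>: "H.nrm \<nu> \<le> 2 * n + \<eta>"
    using H.nrm_triangle[OF ua ubH] nrm_u[of b] ab by (simp add: \<nu>_def n_def)
  \<comment> \<open>The test function is \<open>2 u(a)\<close> plus the drift
    \<open>u(b) - u(a)\<close>, whose pairing with \<open>u(a)\<close> is at most
    \<open>n * \<eta>\<close> in absolute value.\<close>
  have lower: "2 * n\<^sup>2 - n * \<eta> \<le> H_inner (u a) \<nu>"
  proof -
    have "H_inner (u a) \<nu> = 2 * n\<^sup>2 + H_inner (u a) (\<lambda>x. u b x - u a x)"
      using ua ubH by (simp add: \<nu>_def n_def H.nrm_square H.add_right H.diff_right)
    moreover have "\<bar>H_inner (u a) (\<lambda>x. u b x - u a x)\<bar> \<le> n * \<eta>"
      using H.Cauchy_Schwarz[OF ua H.diff_mem[OF ubH ua]]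
        mult_left_mono[OF close[of b] n0] ab by (simp add: n_def)
    ultimately show ?thesis by linarith
  qed
  have bound: "L2_inner \<Omega> (\<lambda>x. \<bar>u t x\<bar> powr (p - 2) * u t x) \<nu> - H_inner (u t) \<nu> \<le> ?R"
    if t: "t \<in> {a..b}" for t
  proof -
    have "L2_inner \<Omega> (\<lambda>x. \<bar>u t x\<bar> powr (p - 2) * u t x) \<nu>
        \<le> C powr p * H.nrm (u t) powr (p - 1) * H.nrm \<nu>"
      by (rule nonlinearity_le[OF p emb mem[OF t] \<nu>])
    also have "\<dots> \<le> C powr p * (n + \<eta>) powr (p - 1) * (2 * n + \<eta>)"
      using p n0 \<eta>0 nrm_u[OF t] nrm_\<nu> H.nrm_nonneg[OF mem[OF t]] H.nrm_nonneg[OF \<nu>]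
      by (intro mult_mono powr_mono2 mult_left_mono) auto
    finally have 1: "L2_inner \<Omega> (\<lambda>x. \<bar>u t x\<bar> powr (p - 2) * u t x) \<nu>
        \<le> C powr p * (n + \<eta>) powr (p - 1) * (2 * n + \<eta>)" .
    have "\<bar>H_inner (\<lambda>x. u t x - u a x) \<nu>\<bar> \<le> H.nrm (\<lambda>x. u t x - u a x) * H.nrm \<nu>"
      by (rule H.Cauchy_Schwarz[OF H.diff_mem[OF mem[OF t] ua] \<nu>])
    also have "\<dots> \<le> \<eta> * (2 * n + \<eta>)"
      by (intro mult_mono close t nrm_\<nu> \<eta>0 H.nrm_nonneg \<nu>)
    finally have "\<bar>H_inner (u t) \<nu> - H_inner (u a) \<nu>\<bar> \<le> \<eta> * (2 * n + \<eta>)"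
      by (simp add: H.diff_left mem[OF t] ua \<nu>)
    with 1 lower show ?thesis by linarith
  qed
  \<comment> \<open>The two forms of the weight agree everywhere, including the origin, where both
    are 0.\<close>
  have hardy_eq: "L2_inner \<Omega> (\<lambda>x. norm x powr (- 2 * s) * \<phi> x) \<nu> = hardy_inner \<phi> \<nu>" for \<phi>
    unfolding L2_inner_def hardy_inner_def
    by (intro Bochner_Integration.integral_cong) (auto simp: powr_minus divide_inverse)
  have sub: "{a<..<b} \<subseteq> {0<..<T}"
    using ab by auto
  have "AE t in lebesgue_on {a<..<b}. t \<in> {a<..<b}"
    by (rule AE_I2) simp
  moreover have "AE t in lebesgue_on {a<..<b}.
      L2_inner \<Omega> (\<lambda>x. norm x powr (- 2 * s) * ut t x) \<nu> + H_inner (u t) \<nu> + H_inner (ut t) \<nu>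
      = L2_inner \<Omega> (\<lambda>x. \<bar>u t x\<bar> powr (p - 2) * u t x) \<nu>"
    by (rule AE_lebesgue_on_subset[OF eq[OF \<nu>] sub]) auto
  ultimately have "AE t in lebesgue_on {a<..<b}. energy_inner (ut t) \<nu> \<le> ?R"
  proof eventually_elim
    case (elim t)
    then show ?case
      using bound[of t] elim(2)[unfolded hardy_eq] by (simp add: energy_inner_def)
  qed
  moreover
  interpret finite_measure "lebesgue_on {a<..<b}"
    by (rule finite_measure_lebesgue_on) auto
  have "integrable (lebesgue_on {a<..<b}) (\<lambda>t. ?R)"
    by simp
  ultimately have "(LINT t|lebesgue_on {a<..<b}. energy_inner (ut t) \<nu>) \<le> (LINT t|lebesgue_on {a<..<b}. ?R)"
    by (intro integral_mono_AE energy_inner_increment(1)[OF ut(1) u ut(2) ab \<nu>])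
  also have "\<dots> = (b - a) * ?R"
    using ab by (simp add: measure_restrict_space)
  also have "(LINT t|lebesgue_on {a<..<b}. energy_inner (ut t) \<nu>) = energy_inner (u b) \<nu> - energy_inner (u a) \<nu>"
    by (rule energy_inner_increment(2)[OF ut(1) u ut(2) ab \<nu>, symmetric])
  also have "\<dots> = energy \<Omega> e lam s (u b) - energy \<Omega> e lam s (u a)"
    using E.sym[OF ua ubH] by (simp add: energy_eq ua ubH \<nu>_def E.add_right)
  finally show ?thesis .
qed

lemma energy_growth:
  assumes sol: "weak_solution \<Omega> e lam s p u0 T u"
    and p: "p > 1" and emb: "embedding_inequality \<Omega> e lam s p C" "C > 0"
    and a: "a \<in> {0..<T}" and "\<epsilon> > 0"
  shows "\<exists>\<delta>>0. \<forall>b. a < b \<and> b < a + \<delta> \<and> b < T \<longrightarrow> energy \<Omega> e lam s (u b)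
    \<le> energy \<Omega> e lam s (u a) + (b - a) * (2 * C powr p * energy \<Omega> e lam s (u a) powr (p / 2) + \<epsilon>)"
proof -
  have u: "Hs0_continuous \<Omega> e lam s T u"
    using sol by (simp add: weak_solution_def)
  have ua: "u a \<in> H"
    by (rule Hs0_continuous_mem[OF u a])
  define n where "n = H.nrm (u a)"
  have n0: "n \<ge> 0"
    unfolding n_def by (rule H.nrm_nonneg[OF ua])
  define R where "R \<eta> = C powr p * (n + \<eta>) powr (p - 1) * (2 * n + \<eta>) - 2 * n\<^sup>2 + n * \<eta> + \<eta> * (2 * n + \<eta>)" for \<eta>
  have id: "((\<lambda>\<eta>. \<eta>) \<longlongrightarrow> 0) (at_right (0::real))"
    by (rule tendsto_ident_at)
  have "(R \<longlongrightarrow> C powr p * (n + 0) powr (p - 1) * (2 * n + 0) - 2 * n\<^sup>2 + n * 0 + 0 * (2 * n + 0)) (at_right 0)"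
    unfolding R_def
  proof (intro tendsto_intros tendsto_powr' id)
    \<comment> \<open>For \<open>n = 0\<close> the base of the power tends to 0; the limit then
      relies on the positive exponent and on approaching 0 from the right.\<close>
    show "n + 0 \<noteq> 0 \<or> 0 < p - 1 \<and> (\<forall>\<^sub>F \<eta> in at_right 0. 0 \<le> n + \<eta>)"
      using p n0 by (auto simp: eventually_at_filter intro!: always_eventually)
  qed
  then have "\<forall>\<^sub>F \<eta> in at_right 0. R \<eta> < C powr p * n powr (p - 1) * (2 * n) - 2 * n\<^sup>2 + \<epsilon>"
    using \<open>\<epsilon> > 0\<close> by (intro order_tendstoD(2)) auto
  then have "\<forall>\<^sub>F \<eta> in at_right 0. R \<eta> < C powr p * n powr (p - 1) * (2 * n) - 2 * n\<^sup>2 + \<epsilon> \<and> \<eta> > 0"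
    by (intro eventually_conj eventually_at_right_less)
  then obtain \<eta> where \<eta>: "\<eta> > 0" and R: "R \<eta> < C powr p * n powr (p - 1) * (2 * n) - 2 * n\<^sup>2 + \<epsilon>"
    using eventually_happens'[OF trivial_limit_at_right_real] by blast
  have "n powr (p - 1) * n = n powr p"
    using powr_add[of n "p - 1" 1] n0 by (cases "n = 0") auto
  also have "\<dots> \<le> energy \<Omega> e lam s (u a) powr (p / 2)"
  proof -
    have "n powr p \<le> E.nrm (u a) powr p"
      using p n0 norm_le_energy[OF ua] by (intro powr_mono2) (auto simp: n_def)
    also have "\<dots> = energy \<Omega> e lam s (u a) powr (p / 2)"
      using E.nonneg[OF ua] by (simp add: energy_eq ua E.nrm_def powr_half_sqrt[symmetric] powr_powr)
    finally show ?thesis .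
  qed
  finally have *: "C powr p * (n powr (p - 1) * n) \<le> C powr p * energy \<Omega> e lam s (u a) powr (p / 2)"
    by (rule mult_left_mono) simp
  have R': "R \<eta> \<le> 2 * C powr p * energy \<Omega> e lam s (u a) powr (p / 2) + \<epsilon>"
  proof -
    have "C powr p * n powr (p - 1) * (2 * n) = 2 * (C powr p * (n powr (p - 1) * n))"
      by simp
    \<comment> \<open>The diffusion term \<open>-2 * n\<^sup>2\<close> is discarded here.\<close>
    with R zero_le_power2[of n]
    have "R \<eta> \<le> 2 * (C powr p * (n powr (p - 1) * n)) + \<epsilon>"
      by linarith
    with * show ?thesis by simp
  qed
  \<comment> \<open>With \<eta> fixed by the size of the error, continuity in time determines how
    long \<open>u\<close> stays within \<eta> of \<open>u a\<close>.\<close>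
  have "\<forall>\<^sub>F r in at a within {0..<T}. H.nrm (\<lambda>x. u r x - u a x) < \<eta>"
    using Hs0_continuous_tendsto[OF u a] \<eta> by (rule order_tendstoD)
  then obtain \<delta> where \<delta>: "\<delta> > 0"
    and near: "\<And>r. r \<in> {0..<T} \<Longrightarrow> r \<noteq> a \<Longrightarrow> dist r a < \<delta> \<Longrightarrow> H.nrm (\<lambda>x. u r x - u a x) < \<eta>"
    unfolding eventually_at by blast
  have "energy \<Omega> e lam s (u b) \<le> energy \<Omega> e lam s (u a)
      + (b - a) * (2 * C powr p * energy \<Omega> e lam s (u a) powr (p / 2) + \<epsilon>)"
    if b: "a < b" "b < a + \<delta>" "b < T" for b
  proof -
    have "H.nrm (\<lambda>x. u t x - u a x) \<le> \<eta>" if "t \<in> {a..b}" for t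
    proof (cases "t = a")
      case True
      then show ?thesis
        using \<eta> H.zero_left[OF H.zero_mem] by (simp add: H.nrm_def)
    next
      case False
      then show ?thesis
        using near[of t] that a b by (auto simp: dist_real_def)
    qed
    then have "energy \<Omega> e lam s (u b) - energy \<Omega> e lam s (u a) \<le> (b - a) * R \<eta>"
      unfolding R_def n_def using a b by (intro energy_increment_le[OF sol p emb]) auto
    also have "\<dots> \<le> (b - a) * (2 * C powr p * energy \<Omega> e lam s (u a) powr (p / 2) + \<epsilon>)"
      using b R' by (intro mult_left_mono) auto
    finally show ?thesis by simp
  qed
  with \<delta> show ?thesis by blast
qed

lemma energy_continuous:
  assumes u: "Hs0_continuous \<Omega> e lam s T u"
  shows "continuous_on {0..<T} (\<lambda>t. energy \<Omega> e lam s (u t))"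
proof -
  have "continuous_on {0..<T} (\<lambda>t. E.nrm (u t))"
    unfolding continuous_on_def
  proof
    fix t assume t: "t \<in> {0..<T}"
    have mem: "\<forall>\<^sub>F r in at t within {0..<T}. u r \<in> H"
      using eventually_at_within_mem by (rule eventually_mono) (rule Hs0_continuous_mem[OF u])
    have lim: "((\<lambda>r. E.nrm (\<lambda>x. u r x - u t x)) \<longlongrightarrow> 0) (at t within {0..<T})"
      using mem by (intro energy_tendsto_0 Hs0_continuous_tendsto[OF u t])
        (auto elim!: eventually_mono intro!: H.diff_mem Hs0_continuous_mem[OF u t])
    have "((\<lambda>r. E.nrm (u r) - E.nrm (u t)) \<longlongrightarrow> 0) (at t within {0..<T})"
    proof (rule Lim_null_comparison[OF _ lim])
      show "\<forall>\<^sub>F r in at t within {0..<T}. norm (E.nrm (u r) - E.nrm (u t)) \<le> E.nrm (\<lambda>x. u r x - u t x)"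
        using mem by eventually_elim (simp add: E.nrm_diff_abs_le Hs0_continuous_mem[OF u t])
    qed
    then show "((\<lambda>r. E.nrm (u r)) \<longlongrightarrow> E.nrm (u t)) (at t within {0..<T})"
      by (rule Lim_null[THEN iffD2])
  qed
  then have "continuous_on {0..<T} (\<lambda>t. (E.nrm (u t))\<^sup>2)"
    by (intro continuous_intros)
  then show ?thesis
    by (rule continuous_on_eq) (simp add: E.nrm_square energy_eq Hs0_continuous_mem[OF u])
qed

end


section \<open>Comparison with the blow-up ODE\<close>

text \<open>At the last time before a violation where \<open>f \<le> g\<close> still holds,
  continuity forces equality, and the local hypothesis at touching points extends the inequality a
  little further, a contradiction.\<close>

lemma comparison_principle:
  fixes f g :: "real \<Rightarrow> real"
  assumes cont: "continuous_on {a..<b} f" "continuous_on {a..<b} g" and le: "f a \<le> g a"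
    and touch: "\<And>t. t \<in> {a..<b} \<Longrightarrow> f t = g t \<Longrightarrow>
      \<exists>\<delta>>0. \<forall>r. t < r \<and> r < t + \<delta> \<and> r < b \<longrightarrow> f r \<le> g r"
    and t: "t \<in> {a..<b}"
  shows "f t \<le> g t"
proof (rule ccontr)
  assume "\<not> f t \<le> g t"
  then have gt: "f t > g t" by simp
  define S where "S = {r \<in> {a..t}. f r \<le> g r}"
  have sub: "{a..t} \<subseteq> {a..<b}"
    using t by auto
  note cont' = continuous_on_subset[OF cont(1) sub] continuous_on_subset[OF cont(2) sub]
  have "closed S"
    unfolding S_def using cont' by (intro continuous_on_closed_Collect_le) auto
  moreover have "a \<in> S"
    using le t by (simp add: S_def)
  moreover have bdd: "bdd_above S"
    by (rule bdd_aboveI[of _ t]) (simp add: S_def)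
  moreover define c where "c = Sup S"
  ultimately have c: "c \<in> S"
    using closed_contains_Sup[of S] by blast
  have c_prop: "a \<le> c" "c < t" "f c \<le> g c"
    using c gt by (auto simp: S_def order_less_le)
  have above: "f r > g r" if "c < r" "r \<le> t" for r
  proof (rule ccontr)
    assume "\<not> f r > g r"
    then have "r \<in> S"
      using that c_prop by (simp add: S_def)
    then show False
      using cSup_upper[OF _ bdd] that unfolding c_def[symmetric] by fastforce
  qed
  have "f c = g c"
  proof -
    have "\<exists>r\<ge>c. r \<le> t \<and> f r - g r = 0"
      using c_prop gt by (intro IVT' continuous_intros continuous_on_subset[OF cont'(1)]
          continuous_on_subset[OF cont'(2)]) auto
    then obtain r where r: "c \<le> r" "r \<le> t" "f r = g r" by auto
    then show ?thesis
      using above[of r] by (cases "r = c") auto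
  qed
  then obtain \<delta> where \<delta>: "\<delta> > 0" "\<And>r. c < r \<Longrightarrow> r < c + \<delta> \<Longrightarrow> r < b \<Longrightarrow> f r \<le> g r"
    using touch[of c] c_prop t by auto
  define r where "r = min t (c + \<delta> / 2)"
  have "c < r" "r \<le> t" "r < c + \<delta>" "r < b"
    using \<delta> c_prop t by (auto simp: r_def min_def)
  then show False
    using above[of r] \<delta>(2)[of r] by simp
qed

text \<open>A supersolution \<theta>-close to the extremal profile still lies above \<open>f\<close>
  at \<open>t0\<close> if the claim fails. Shifting the blow-up time to \<open>T + \<theta>\<close>
  keeps it bounded up to \<open>T\<close>; raising \<open>c\<close> to \<open>c + \<theta>\<close>
  makes it strictly steeper than \<open>f\<close> at any touching point.\<close>

lemma blow_up_lower_bound: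
  fixes f :: "real \<Rightarrow> real"
  assumes p: "p > 2" and c: "c > 0" and cont: "continuous_on {0..<T} f"
    and growth: "\<And>t \<epsilon>. t \<in> {0..<T} \<Longrightarrow> \<epsilon> > 0 \<Longrightarrow>
      \<exists>\<delta>>0. \<forall>r. t < r \<and> r < t + \<delta> \<and> r < T \<longrightarrow> f r \<le> f t + (r - t) * (2 * c * f t powr (p / 2) + \<epsilon>)"
    and blow_up: "filterlim f at_top (at_left T)"
    and t0: "t0 \<in> {0..<T}"
  shows "(c * (p - 2) * (T - t0)) powr (2 / (2 - p)) \<le> f t0"
proof (rule ccontr)
  assume "\<not> ?thesis"
  then have less: "f t0 < (c * (p - 2) * (T - t0)) powr (2 / (2 - p))" by simp
  \<comment> \<open>The exponent for which \<open>(A * (T + \<theta> - t)) powr (- m)\<close> solves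
    the equation: differentiation lowers it to \<open>- m - 1 = - m * (p / 2)\<close>, and
    \<open>m * (p - 2) = 2\<close> produces the factor 2.\<close>
  define m where "m = 2 / (p - 2)"
  have m: "m > 0" "2 / (2 - p) = - m" "m * (p - 2) = 2" "- m * (p / 2) = - m - 1"
    using p by (auto simp: m_def field_simps)
  have "((\<lambda>\<theta>. ((c + \<theta>) * (p - 2) * (T + \<theta> - t0)) powr (- m)) \<longlongrightarrow>
      ((c + 0) * (p - 2) * (T + 0 - t0)) powr (- m)) (at_right 0)"
    using p c t0 by (intro tendsto_intros) auto
  then have "\<forall>\<^sub>F \<theta> in at_right 0. f t0 < ((c + \<theta>) * (p - 2) * (T + \<theta> - t0)) powr (- m)"
    using less by (intro order_tendstoD(1)) (auto simp: m)
  then have "\<forall>\<^sub>F \<theta> in at_right 0. f t0 < ((c + \<theta>) * (p - 2) * (T + \<theta> - t0)) powr (- m) \<and> \<theta> > 0"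
    by (intro eventually_conj eventually_at_right_less)
  then obtain \<theta> where \<theta>: "\<theta> > 0" and less': "f t0 < ((c + \<theta>) * (p - 2) * (T + \<theta> - t0)) powr (- m)"
    using eventually_happens'[OF trivial_limit_at_right_real] by blast
  define y where "y t = ((c + \<theta>) * (p - 2) * (T + \<theta> - t)) powr (- m)" for t
  have base: "(c + \<theta>) * (p - 2) * (T + \<theta> - t) > 0" if "t < T" for t
    using that p c \<theta> by (intro mult_pos_pos) auto
  have y_pos: "y t > 0" if "t < T" for t
    unfolding y_def powr_gt_zero using base[OF that] by (rule less_imp_neq[THEN not_sym])
  have y_deriv: "(y has_real_derivative 2 * (c + \<theta>) * y t powr (p / 2)) (at t)" if "t < T" for t
  proof -
    define A where "A = (c + \<theta>) * (p - 2)"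
    have "((\<lambda>t. (A * (T + \<theta> - t)) powr (- m)) has_real_derivative
        A * m * (A * (T + \<theta> - t)) powr (- m - 1)) (at t)"
      using base[OF that] unfolding A_def[symmetric]
      by (auto intro!: derivative_eq_intros simp: mult_ac)
    then have "(y has_real_derivative
        (c + \<theta>) * (p - 2) * m * ((c + \<theta>) * (p - 2) * (T + \<theta> - t)) powr (- m - 1)) (at t)"
      unfolding A_def y_def .
    moreover have "((c + \<theta>) * (p - 2) * (T + \<theta> - t)) powr (- m - 1) = y t powr (p / 2)"
      unfolding y_def powr_powr m(4) ..
    moreover have "(c + \<theta>) * (p - 2) * m = 2 * (c + \<theta>)"
      by (metis m(3) mult.assoc mult.commute)
    ultimately show ?thesis by simp
  qed
  have f_le_y: "f t \<le> y t" if "t \<in> {t0..<T}" for t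
  proof (rule comparison_principle[OF _ _ _ _ that])
    show "continuous_on {t0..<T} f"
      using cont by (rule continuous_on_subset) (use t0 in auto)
    show "continuous_on {t0..<T} y"
      by (intro continuous_at_imp_continuous_on ballI DERIV_isCont[OF y_deriv]) simp
    show "f t0 \<le> y t0"
      using less' by (simp add: y_def)
    fix t assume t: "t \<in> {t0..<T}" and eq: "f t = y t"
    \<comment> \<open>Half of the excess slope \<open>2 * \<theta> * y t powr (p / 2)\<close> is
      spent on the error in the growth bound, the other half on the difference quotient of
      \<open>y\<close>.\<close>
    define \<epsilon> where "\<epsilon> = \<theta> * y t powr (p / 2)"
    have \<epsilon>: "\<epsilon> > 0"
      using \<theta> y_pos[of t] t by (simp add: \<epsilon>_def)
    obtain \<delta>1 where \<delta>1: "\<delta>1 > 0"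
      "\<And>r. t < r \<Longrightarrow> r < t + \<delta>1 \<Longrightarrow> r < T \<Longrightarrow> f r \<le> f t + (r - t) * (2 * c * f t powr (p / 2) + \<epsilon>)"
      using growth[of t \<epsilon>] t t0 \<epsilon> by auto
    have "((\<lambda>r. (y r - y t) / (r - t)) \<longlongrightarrow> 2 * (c + \<theta>) * y t powr (p / 2)) (at t)"
      using y_deriv[of t] t by (simp add: has_field_derivative_iff)
    then have "\<forall>\<^sub>F r in at t. 2 * c * y t powr (p / 2) + \<epsilon> < (y r - y t) / (r - t)"
      using \<epsilon> by (intro order_tendstoD(1)) (auto simp: \<epsilon>_def algebra_simps)
    then obtain \<delta>2 where \<delta>2: "\<delta>2 > 0"
      "\<And>r. r \<noteq> t \<Longrightarrow> dist r t < \<delta>2 \<Longrightarrow> 2 * c * y t powr (p / 2) + \<epsilon> < (y r - y t) / (r - t)"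
      unfolding eventually_at by auto
    have "f r \<le> y r" if r: "t < r" "r < t + min \<delta>1 \<delta>2" "r < T" for r
    proof -
      have "2 * c * y t powr (p / 2) + \<epsilon> < (y r - y t) / (r - t)"
        using \<delta>2(2)[of r] r by (simp add: dist_real_def)
      then have "(r - t) * (2 * c * y t powr (p / 2) + \<epsilon>) < y r - y t"
        using r by (simp add: less_divide_eq mult.commute)
      moreover have "r < t + \<delta>1"
        using r by simp
      ultimately show ?thesis
        using \<delta>1(2)[of r] r(1,3) eq by simp
    qed
    then show "\<exists>\<delta>>0. \<forall>r. t < r \<and> r < t + \<delta> \<and> r < T \<longrightarrow> f r \<le> y r"
      using \<delta>1 \<delta>2 by (intro exI[of _ "min \<delta>1 \<delta>2"]) auto
  qed
  \<comment> \<open>\<open>y T\<close> is finite since the profile blows up only at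
    \<open>T + \<theta>\<close>, and monotonicity makes it a bound for \<open>y\<close> before
    \<open>T\<close>.\<close>
  have "\<forall>\<^sub>F t in at_left T. y T < f t"
    using blow_up by (rule filterlim_at_top_dense[THEN iffD1, rule_format])
  moreover have "\<forall>\<^sub>F t in at_left T. t \<in> {t0<..<T}"
    using t0 by (intro eventually_at_leftI[of t0]) auto
  ultimately have "\<forall>\<^sub>F t in at_left T. y T < f t \<and> t \<in> {t0<..<T}"
    by (rule eventually_conj)
  then obtain t where t: "y T < f t" "t \<in> {t0<..<T}"
    using eventually_happens'[OF trivial_limit_at_left_real] by blast
  have "y t \<le> y T"
    unfolding y_def using t m p c \<theta> by (intro powr_mono2') (auto intro!: mult_left_mono)
  with f_le_y[of t] t show False by simp
qed

theorem theorem3p3: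
  fixes \<Omega> :: "'a::euclidean_space set"
    and e :: "nat \<Rightarrow> 'a \<Rightarrow> real" and lam :: "nat \<Rightarrow> real"
    and s p C T :: real
    and u0 :: "'a \<Rightarrow> real" and u :: "real \<Rightarrow> 'a \<Rightarrow> real"
  assumes "0 < s" "s < 1" "real DIM('a) > 2 * s"
    and "open \<Omega>" "bounded \<Omega>" "smooth_boundary \<Omega>"
    and "2 < p" "p \<le> 2 * real DIM('a) / (real DIM('a) - 2 * s)"
    and "dirichlet_eigensystem \<Omega> e lam"
    and "\<exists>K>0. hardy_inequality \<Omega> e lam s K"
    and "best_embedding_constant \<Omega> e lam s p C"
    and "u0 \<in> Hs0 \<Omega> e lam s"
    and "maximal_weak_solution \<Omega> e lam s p u0 (ereal T) u"
    and "filterlim (\<lambda>t. energy \<Omega> e lam s (u t)) at_top (at_left T)"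
  shows "T \<ge> 1 / (C powr p * (p - 2)) * energy \<Omega> e lam s u0 powr ((2 - p) / 2) \<and>
         (\<forall>t\<in>{0..<T}. energy \<Omega> e lam s (u t) \<ge>
            C powr (2 * p / (2 - p)) * (p - 2) powr (2 / (2 - p)) * (T - t) powr (2 / (2 - p)))"
proof -
  obtain K where K: "K > 0" "hardy_inequality \<Omega> e lam s K"
    using assms(10) by blast
  interpret hardy_system \<Omega> e lam s K
    by unfold_locales (use assms K in auto)
  have C: "C > 0" and emb: "embedding_inequality \<Omega> e lam s p C"
    using assms(11) by (auto simp: best_embedding_constant_def)
  have sol: "weak_solution \<Omega> e lam s p u0 T' u" if "0 < T'" "T' < T" for T'
    using assms(13) that by (simp add: maximal_weak_solution_def)
  have T: "T > 0"
  proof -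
    let ?S = "{T'. T' > 0 \<and> (\<exists>w. weak_solution \<Omega> e lam s p u0 T' w)}"
    have Sup: "ereal T = (SUP T'\<in>?S. ereal T')"
      using assms(13) by (simp add: maximal_weak_solution_def max_existence_time_def)
    \<comment> \<open>An empty supremum in the extended reals is minus infinity, which no real
      \<open>T\<close> equals; so some solution exists on an interval of positive length.\<close>
    have "?S \<noteq> {}"
    proof
      assume "?S = {}"
      with Sup have "ereal T = Sup {}"
        by (metis image_empty)
      then show False
        by (simp add: bot_ereal_def)
    qed
    then obtain T' where "T' \<in> ?S" by blast
    moreover from this have "ereal T' \<le> ereal T"
      unfolding Sup by (rule SUP_upper)
    ultimately show ?thesis by simp
  qed
  define f where "f t = energy \<Omega> e lam s (u t)" for t
  have cont: "continuous_on {0..<T} f"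
    unfolding continuous_on_eq_continuous_within
  proof
    fix t assume t: "t \<in> {0..<T}"
    \<comment> \<open>\<open>u\<close> is a weak solution only on intervals shorter than
      \<open>[0,T)\<close>. Continuity at t is local, so an intermediate \<open>T'\<close>
      suffices.\<close>
    define T' where "T' = (t + T) / 2"
    have T': "0 < T'" "T' < T" "t < T'"
      using t by (auto simp: T'_def)
    have "continuous_on {0..<T'} f"
      unfolding f_def using sol[OF T'(1,2)] by (intro energy_continuous) (simp add: weak_solution_def)
    then have "continuous (at t within {0..<T'}) f"
      using t T' by (simp add: continuous_on_eq_continuous_within)
    moreover have "at t within {0..<T'} = at t within {0..<T}"
      by (rule at_within_nhd[of _ "{..<T'}"]) (use T' in auto)
    ultimately show "continuous (at t within {0..<T}) f" by simp
  qed
  have growth: "\<exists>\<delta>>0. \<forall>r. t < r \<and> r < t + \<delta> \<and> r < T \<longrightarrow>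
      f r \<le> f t + (r - t) * (2 * C powr p * f t powr (p / 2) + \<epsilon>)"
    if t: "t \<in> {0..<T}" and \<epsilon>: "\<epsilon> > 0" for t \<epsilon>
  proof -
    define T' where "T' = (t + T) / 2"
    have T': "0 < T'" "T' < T" "t < T'"
      using t by (auto simp: T'_def)
    obtain \<delta> where "\<delta> > 0" "\<And>r. t < r \<Longrightarrow> r < t + \<delta> \<Longrightarrow> r < T' \<Longrightarrow>
        f r \<le> f t + (r - t) * (2 * C powr p * f t powr (p / 2) + \<epsilon>)"
      using energy_growth[OF sol[OF T'(1,2)] _ emb C, of t \<epsilon>] assms(7) t T' \<epsilon> unfolding f_def by auto
    then show ?thesis
      \<comment> \<open>Shrinking the step keeps r below \<open>T'\<close>, where the solution
        property is available.\<close>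
      using T' by (intro exI[of _ "min \<delta> (T' - t)"]) auto
  qed
  have bound: "(C powr p * (p - 2) * (T - t)) powr (2 / (2 - p)) \<le> f t" if "t \<in> {0..<T}" for t
    using blow_up_lower_bound[OF assms(7) _ cont growth assms(14)[folded f_def] that] C by simp
  have "energy \<Omega> e lam s u0 = f 0"
  proof -
    have "weak_solution \<Omega> e lam s p u0 (T / 2) u"
      using T by (intro sol) auto
    then have "AE x in lebesgue_on \<Omega>. u 0 x = u0 x" "u 0 \<in> H"
      using T by (auto simp: weak_solution_def Hs0_continuous_def)
    then show ?thesis
      unfolding f_def using assms(12) by (intro energy_cong_AE[symmetric] Hs0_L2)
  qed
  moreover have "f 0 powr ((2 - p) / 2) \<le> C powr p * (p - 2) * T"
  proof -
    have pos: "C powr p * (p - 2) * T > 0"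
      using C assms(7) T by simp
    \<comment> \<open>The exponent \<open>(2 - p) / 2\<close> is negative, so raising the bound at
      time 0 to this power reverses it; it is also the reciprocal of
      \<open>2 / (2 - p)\<close>.\<close>
    have "f 0 powr ((2 - p) / 2) \<le> ((C powr p * (p - 2) * T) powr (2 / (2 - p))) powr ((2 - p) / 2)"
      using bound[of 0] T pos assms(7) by (intro powr_mono2') auto
    also have "\<dots> = C powr p * (p - 2) * T"
    proof -
      have "2 / (2 - p) * ((2 - p) / 2) = 1"
        using assms(7) by simp
      then show ?thesis
        unfolding powr_powr using pos by (simp only: powr_one_gt_zero_iff)
    qed
    finally show ?thesis .
  qed
  ultimately have "1 / (C powr p * (p - 2)) * energy \<Omega> e lam s u0 powr ((2 - p) / 2) \<le> T"
    using C assms(7) by (simp add: divide_le_eq mult.commute)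
  moreover have "C powr (2 * p / (2 - p)) * (p - 2) powr (2 / (2 - p)) * (T - t) powr (2 / (2 - p))
      \<le> energy \<Omega> e lam s (u t)" if "t \<in> {0..<T}" for t
  proof -
    have "C powr (2 * p / (2 - p)) * (p - 2) powr (2 / (2 - p)) * (T - t) powr (2 / (2 - p))
        = (C powr p * (p - 2) * (T - t)) powr (2 / (2 - p))"
      using C assms(7) that by (simp add: powr_mult powr_powr mult.commute)
    with bound[OF that] show ?thesis by (simp add: f_def)
  qed
  ultimately show ?thesis by blast
qed

end
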